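(* Let $(A,\rhd_A,\lhd_A)$ be a dialgebra and $r\in A\otimes A$ be such that its skew-symmetric part $\alpha=r-\tau(r)$ is invariant. Define $\delta_{\rhd,r},\delta_{\lhd,r}:A\to A\otimes A$ by $$\delta_{\rhd,r}(x)=\big(R_{\star}(x)\otimes\mathrm{id}+\mathrm{id}\otimes L_{\lhd}(x)\big)r,\qquad \delta_{\lhd,r}(x)=\big(R_{\rhd}(x)\otimes\mathrm{id}-\mathrm{id}\otimes L_{\star}(x)\big)r,$$ and binary operations $\rhd_{A^*},\lhd_{A^*}$ on $A^*$ by $$a^*\rhd_{A^*}b^*=L_{\star}^*(\widetilde{\alpha}(b^* ))a^*,\qquad a^*\lhd_{A^*}b^*=L_{\rhd}^*(\widetilde{\alpha}(b^* ))a^*.$$ Then the following conditions are equivalent: (a) $r$ is a solution of the diassociative Yang-Baxter equation (DAYBE) in $(A,\rhd_A,\lhd_A)$ such that $(A,\rhd_A,\lhd_A,\delta_{\rhd,r},\delta_{\lhd,r})$ is a quasi-triangular bi-dialgebra. (b) $\widetilde{r}:A^*\to A$ is an $\mathcal{O}$-operator of weight $1$ on $(A,\rhd_A,\lhd_A)$ associated to the $A$-bimodule dialgebra $(A^*,\rhd_{A^*},\lhd_{A^*};-R_{\lhd}^*,-L_{\star}^*,R_{\star}^*,-L_{\rhd}^* )$. (c) $\widetilde{r}^t:A^*\to A$ is an $\mathcal{O}$-operator of weight $-1$ on $(A,\rhd_A,\lhd_A)$ associated to the $A$-bimodule dialgebra $(A^*,\rhd_{A^*},\lhd_{A^*};-R_{\lhd}^*,-L_{\star}^*,R_{\star}^*,-L_{\rhd}^*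 )$.
   Context: All vector spaces and algebras are finite-dimensional over a field $\mathbb F$ of characteristic $0$; algebras are not assumed unital. **Dialgebra.** $(A,\rhd,\lhd)$ where $\rhd,\lhd$ are associative bilinear products with $(x\lhd y)\lhd z=x\lhd(y\rhd z)$, $(x\rhd y)\lhd z=x\rhd(y\lhd z)$, $(x\lhd y)\rhd z=x\rhd(y\rhd z)$. **Notation.** $x\star y=x\rhd y-x\lhd y$; $L_\diamond(x)y=x\diamond y=R_\diamond(y)x$; $\tau(x\otimes y)=y\otimes x$ ($L_\rhd$, $R_\lhd$, $L_\star$, etc. refer to $\rhd_A,\lhd_A$). For linear $\varphi:A\to\mathrm{End}(V)$, $\varphi^*:A\to\mathrm{End}(V^* )$ is given by $\langle\varphi^*(x)v^*,u\rangle=-\langle v^*,\varphi(x)u\rangle$. For $r\in A\otimes A$: $\langle\widetilde{r}(u^* ),v^*\rangle=\langle r,u^*\otimes v^*\rangle=\langle\widetilde{r}^t(v^* ),u^*\rangle$ defines $\widetilde r,\widetilde r^t:A^*\to A$; similarly $\widetilde\alpha$ (so $\widetilde\alpha=\widetilde r-\widetilde r^t$). **DAYBE and invariance.** $r=\sum_i a_i\otimes b_i$ is a solution of the DAYBE if $\sum_{i,j}\big(a_i\otimes a_j\otimes b_i\rhd b_j-a_j\otimes a_i\lhd b_j\otimes b_i-a_i\star a_j\otimes b_i\otimes b_j\big)=0$. An element $s\in A\otimes A$ is invariant if $(R_{\star}(x)\otimes\mathrm{id}+\mathrm{id}\otimes L_{\lhd}(x))s=0=(R_{\rhd}(x)\otimes\mathrm{id}-\mathrm{id}\otimes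 L_{\star}(x))s$ for all $x\in A$. **Bimodules.** A bimodule of an associative algebra $(A,\cdot)$ is $(V;l,r)$ with $l,r:A\to\mathrm{End}(V)$ linear, $l(x\cdot y)=l(x)l(y)$, $r(x\cdot y)=r(y)r(x)$, $l(x)r(y)=r(y)l(x)$. A bimodule of a dialgebra is $(V;l_{\rhd},r_{\rhd},l_{\lhd},r_{\lhd})$ where $(V;l_{\rhd},r_{\rhd})$, $(V;l_{\lhd},r_{\lhd})$ are bimodules of $(A,\rhd)$, $(A,\lhd)$ and $r_{\lhd}(x\lhd y)=r_{\lhd}(x\rhd y)$, $l_{\lhd}(x)r_{\lhd}(y)=l_{\lhd}(x)r_{\rhd}(y)$, $l_{\lhd}(x)l_{\lhd}(y)=l_{\lhd}(x)l_{\rhd}(y)$, $r_{\lhd}(x)r_{\rhd}(y)=r_{\rhd}(y\lhd x)$, $r_{\lhd}(x)l_{\rhd}(y)=l_{\rhd}(y)r_{\lhd}(x)$, $l_{\lhd}(x\rhd y)=l_{\rhd}(x)l_{\lhd}(y)$, $r_{\rhd}(x)r_{\lhd}(y)=r_{\rhd}(x)r_{\rhd}(y)$, $r_{\rhd}(x)l_{\lhd}(y)=r_{\rhd}(x)l_{\rhd}(y)$, $l_{\rhd}(x\lhd y)=l_{\rhd}(x\rhd y)$. **$A$-bimodule dialgebra.** An $A$-bimodule algebra of an associative algebra $(A,\cdot_A)$ is $(V,\cdot_V;l,r)$ with $(V,\cdot_V)$ associative, $(V;l,r)$ a bimodule of $(A,\cdot_A)$, and $l(x)(a\cdot_V b)=(l(x)a)\cdot_V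 b$, $r(x)(a\cdot_V b)=a\cdot_V(r(x)b)$, $(r(x)a)\cdot_V b=a\cdot_V(l(x)b)$. An $A$-bimodule dialgebra of $(A,\rhd_A,\lhd_A)$ is $(V,\rhd_V,\lhd_V;l_{\rhd},r_{\rhd},l_{\lhd},r_{\lhd})$ with $(V,\rhd_V,\lhd_V)$ a dialgebra, $(V;l_{\rhd},r_{\rhd},l_{\lhd},r_{\lhd})$ a bimodule of $(A,\rhd_A,\lhd_A)$, $(V,\rhd_V;l_{\rhd},r_{\rhd})$ and $(V,\lhd_V;l_{\lhd},r_{\lhd})$ $A$-bimodule algebras of $(A,\rhd_A)$ and $(A,\lhd_A)$, and for $x\in A$, $a,b\in V$: $l_{\lhd}(x)(a\lhd_V b)=l_{\lhd}(x)(a\rhd_V b)$, $a\lhd_V(l_{\lhd}(x)b)=a\lhd_V(l_{\rhd}(x)b)$, $a\lhd_V(r_{\lhd}(x)b)=a\lhd_V(r_{\rhd}(x)b)$, $l_{\rhd}(x)(a\lhd_V b)=(l_{\rhd}(x)a)\lhd_V b$, $(r_{\rhd}(x)a)\lhd_V b=a\rhd_V(l_{\lhd}(x)b)$, $r_{\lhd}(x)(a\rhd_V b)=a\rhd_V(r_{\lhd}(x)b)$, $(l_{\lhd}(x)a)\rhd_V b=(l_{\rhd}(x)a)\rhd_V b$, $(r_{\lhd}(x)a)\rhd_V b=(r_{\rhd}(x)a)\rhd_V b$, $r_{\rhd}(x)(a\lhd_V b)=r_{\rhd}(x)(a\rhd_V b)$. When $\alpha$ is invariant, $(A^*,\rhd_{A^*},\lhd_{A^*};-R_{\lhd}^*,-L_{\star}^*,R_{\star}^*,-L_{\rhd}^*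 )$ is an $A$-bimodule dialgebra. **$\mathcal O$-operator.** A linear map $T:V\to A$ is an $\mathcal O$-operator of weight $\lambda\in\mathbb F$ on $(A,\rhd_A,\lhd_A)$ associated to $(V,\rhd_V,\lhd_V;l_{\rhd},r_{\rhd},l_{\lhd},r_{\lhd})$ if for all $a,b\in V$: $T(a)\rhd_A T(b)=T(l_{\rhd}(T(a))b+r_{\rhd}(T(b))a+\lambda\,a\rhd_V b)$ and $T(a)\lhd_A T(b)=T(l_{\lhd}(T(a))b+r_{\lhd}(T(b))a+\lambda\,a\lhd_V b)$. **Bi-dialgebras.** A co-dialgebra $(A,\delta_{\rhd},\delta_{\lhd})$ has $\delta_{\rhd},\delta_{\lhd}:A\to A\otimes A$ linear and coassociative with $(\mathrm{id}\otimes\delta_{\lhd})\delta_{\lhd}=(\mathrm{id}\otimes\delta_{\rhd})\delta_{\lhd}$, $(\delta_{\rhd}\otimes\mathrm{id})\delta_{\lhd}=(\mathrm{id}\otimes\delta_{\lhd})\delta_{\rhd}$, $(\delta_{\lhd}\otimes\mathrm{id})\delta_{\rhd}=(\delta_{\rhd}\otimes\mathrm{id})\delta_{\rhd}$. A bi-dialgebra $(A,\rhd,\lhd,\delta_{\rhd},\delta_{\lhd})$ is a dialgebra and co-dialgebra such that, with $\delta_\star=\delta_{\rhd}-\delta_{\lhd}$, for all $x,y\in A$: $(\mathrm{id}\otimes L_{\lhd}(x))\delta_{\lhd}(y)=(R_{\rhd}(y)\otimes\mathrm{id})\delta_{\rhd}(x)$; $(L_{\lhd}(x)\otimes\mathrm{id})\delta_{\rhd}(y)=(\mathrm{id}\otimes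 L_{\lhd}(y))\tau\delta_{\rhd}(x)$; $(R_{\rhd}(x)\otimes\mathrm{id})\tau\delta_{\lhd}(y)=(\mathrm{id}\otimes R_{\rhd}(y))\delta_{\lhd}(x)$; $\delta_{\rhd}(x\rhd y)=(\mathrm{id}\otimes L_{\rhd}(x))\delta_{\rhd}(y)-(R_{\star}(y)\otimes\mathrm{id})\delta_{\star}(x)$; $\delta_{\rhd}(x\lhd y)=(\mathrm{id}\otimes L_{\lhd}(x))\delta_{\star}(y)+(R_{\lhd}(y)\otimes\mathrm{id})\delta_{\rhd}(x)$; $\delta_{\lhd}(x\rhd y)=(\mathrm{id}\otimes L_{\star}(x))\delta_{\lhd}(y)+(R_{\rhd}(y)\otimes\mathrm{id})\delta_{\lhd}(x)$; $\delta_{\lhd}(x\lhd y)=(R_{\lhd}(y)\otimes\mathrm{id})\delta_{\lhd}(x)-(\mathrm{id}\otimes L_{\star}(x))\delta_{\star}(y)$; $(L_{\star}(x)\otimes\mathrm{id})\delta_{\rhd}(y)+(\mathrm{id}\otimes L_{\lhd}(y))\tau\delta_{\lhd}(x)=(R_{\star}(y)\otimes\mathrm{id})\tau\delta_{\star}(x)+(\mathrm{id}\otimes R_{\lhd}(x))\delta_{\rhd}(y)$; $(R_{\lhd}(x)\otimes\mathrm{id})\tau\delta_{\lhd}(y)+(\mathrm{id}\otimes R_{\rhd}(y))\delta_{\star}(x)=(L_{\star}(y)\otimes\mathrm{id})\delta_{\star}(x)+(\mathrm{id}\otimes L_{\rhd}(x))\tau\delta_{\lhd}(y)$. If $r$ is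 a solution of the DAYBE whose skew-symmetric part is invariant, the bi-dialgebra $(A,\rhd,\lhd,\delta_{\rhd,r},\delta_{\lhd,r})$ is called quasi-triangular. *)

theory Defs
  imports Complex_Main "HOL-Library.Function_Algebras"
begin

text \<open>
  The dual space lives inside a function type, so all spaces are given by a carrier set inside
  an additive group; an algebra on a whole type has the carrier UNIV.
\<close>

locale fd_space = vector_space scale
  for scale :: "'f::field_char_0 \<Rightarrow> 'v::ab_group_add \<Rightarrow> 'v" +
  fixes V :: "'v set"
  assumes finite_dim: "\<exists>B. finite B \<and> span B = V"

definition linear_on ::
  "('f::field \<Rightarrow> 'v::ab_group_add \<Rightarrow> 'v) \<Rightarrow> 'v set \<Rightarrow> ('f \<Rightarrow> 'w::ab_group_add \<Rightarrow> 'w) \<Rightarrow> 'w set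
    \<Rightarrow> ('v \<Rightarrow> 'w) \<Rightarrow> bool" where
  "linear_on sV V sW W f \<longleftrightarrow>
     (\<forall>x\<in>V. f x \<in> W) \<and>
     (\<forall>x\<in>V. \<forall>y\<in>V. f (x + y) = f x + f y) \<and>
     (\<forall>c. \<forall>x\<in>V. f (sV c x) = sW c (f x))"

definition bilinear_on ::
  "('f::field \<Rightarrow> 'u::ab_group_add \<Rightarrow> 'u) \<Rightarrow> 'u set \<Rightarrow> ('f \<Rightarrow> 'v::ab_group_add \<Rightarrow> 'v) \<Rightarrow> 'v set
    \<Rightarrow> ('f \<Rightarrow> 'w::ab_group_add \<Rightarrow> 'w) \<Rightarrow> 'w set \<Rightarrow> ('u \<Rightarrow> 'v \<Rightarrow> 'w) \<Rightarrow> bool" where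
  "bilinear_on sU U sV V sW W f \<longleftrightarrow>
     (\<forall>x\<in>U. linear_on sV V sW W (f x)) \<and>
     (\<forall>y\<in>V. linear_on sU U sW W (\<lambda>x. f x y))"

locale assoc_algebra = fd_space scale V
  for scale :: "'f::field_char_0 \<Rightarrow> 'v::ab_group_add \<Rightarrow> 'v" and V +
  fixes m :: "'v \<Rightarrow> 'v \<Rightarrow> 'v"
  assumes bilinear: "bilinear_on scale V scale V scale V m"
    and assoc: "\<lbrakk>x \<in> V; y \<in> V; z \<in> V\<rbrakk> \<Longrightarrow> m (m x y) z = m x (m y z)"

locale dialgebra =
  rhd: assoc_algebra scale V rhd + lhd: assoc_algebra scale V lhd
  for scale :: "'f::field_char_0 \<Rightarrow> 'v::ab_group_add \<Rightarrow> 'v" and V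
    and rhd (infixl "\<rhd>" 70) and lhd (infixl "\<lhd>" 70) +
  assumes lhd_lhd: "\<lbrakk>x \<in> V; y \<in> V; z \<in> V\<rbrakk> \<Longrightarrow> (x \<lhd> y) \<lhd> z = x \<lhd> (y \<rhd> z)"
    and rhd_lhd: "\<lbrakk>x \<in> V; y \<in> V; z \<in> V\<rbrakk> \<Longrightarrow> (x \<rhd> y) \<lhd> z = x \<rhd> (y \<lhd> z)"
    and lhd_rhd: "\<lbrakk>x \<in> V; y \<in> V; z \<in> V\<rbrakk> \<Longrightarrow> (x \<lhd> y) \<rhd> z = x \<rhd> (y \<rhd> z)"

text \<open>
  A linear map from A to End(V) is a map which is bilinear on A and V; it is only relevant on V,
  so identities in End(V) are stated at every vector of V.
\<close>

locale algebra_bimodule =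
  A: assoc_algebra sA A m + V: fd_space sV V
  for sA :: "'f::field_char_0 \<Rightarrow> 'a::ab_group_add \<Rightarrow> 'a" and A and m
    and sV :: "'f \<Rightarrow> 'v::ab_group_add \<Rightarrow> 'v" and V +
  fixes l r :: "'a \<Rightarrow> 'v \<Rightarrow> 'v"
  assumes l_bilinear: "bilinear_on sA A sV V sV V l"
    and r_bilinear: "bilinear_on sA A sV V sV V r"
    and l_mult: "\<lbrakk>x \<in> A; y \<in> A; v \<in> V\<rbrakk> \<Longrightarrow> l (m x y) v = l x (l y v)"
    and r_mult: "\<lbrakk>x \<in> A; y \<in> A; v \<in> V\<rbrakk> \<Longrightarrow> r (m x y) v = r y (r x v)"
    and l_r: "\<lbrakk>x \<in> A; y \<in> A; v \<in> V\<rbrakk> \<Longrightarrow> l x (r y v) = r y (l x v)"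

locale dialgebra_bimodule =
  A: dialgebra sA A rhd lhd +
  rhd: algebra_bimodule sA A rhd sV V lr rr +
  lhd: algebra_bimodule sA A lhd sV V ll rl
  for sA :: "'f::field_char_0 \<Rightarrow> 'a::ab_group_add \<Rightarrow> 'a" and A
    and rhd (infixl "\<rhd>" 70) and lhd (infixl "\<lhd>" 70)
    and sV :: "'f \<Rightarrow> 'v::ab_group_add \<Rightarrow> 'v" and V
    and lr ("l\<^sub>\<rhd>") and rr ("r\<^sub>\<rhd>") and ll ("l\<^sub>\<lhd>") and rl ("r\<^sub>\<lhd>") +
  assumes "\<lbrakk>x \<in> A; y \<in> A; v \<in> V\<rbrakk> \<Longrightarrow> r\<^sub>\<lhd> (x \<lhd> y) v = r\<^sub>\<lhd> (x \<rhd> y) v"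
    and "\<lbrakk>x \<in> A; y \<in> A; v \<in> V\<rbrakk> \<Longrightarrow> l\<^sub>\<lhd> x (r\<^sub>\<lhd> y v) = l\<^sub>\<lhd> x (r\<^sub>\<rhd> y v)"
    and "\<lbrakk>x \<in> A; y \<in> A; v \<in> V\<rbrakk> \<Longrightarrow> l\<^sub>\<lhd> x (l\<^sub>\<lhd> y v) = l\<^sub>\<lhd> x (l\<^sub>\<rhd> y v)"
    and "\<lbrakk>x \<in> A; y \<in> A; v \<in> V\<rbrakk> \<Longrightarrow> r\<^sub>\<lhd> x (r\<^sub>\<rhd> y v) = r\<^sub>\<rhd> (y \<lhd> x) v"
    and "\<lbrakk>x \<in> A; y \<in> A; v \<in> V\<rbrakk> \<Longrightarrow> r\<^sub>\<lhd> x (l\<^sub>\<rhd> y v) = l\<^sub>\<rhd> y (r\<^sub>\<lhd> x v)"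
    and "\<lbrakk>x \<in> A; y \<in> A; v \<in> V\<rbrakk> \<Longrightarrow> l\<^sub>\<lhd> (x \<rhd> y) v = l\<^sub>\<rhd> x (l\<^sub>\<lhd> y v)"
    and "\<lbrakk>x \<in> A; y \<in> A; v \<in> V\<rbrakk> \<Longrightarrow> r\<^sub>\<rhd> x (r\<^sub>\<lhd> y v) = r\<^sub>\<rhd> x (r\<^sub>\<rhd> y v)"
    and "\<lbrakk>x \<in> A; y \<in> A; v \<in> V\<rbrakk> \<Longrightarrow> r\<^sub>\<rhd> x (l\<^sub>\<lhd> y v) = r\<^sub>\<rhd> x (l\<^sub>\<rhd> y v)"
    and "\<lbrakk>x \<in> A; y \<in> A; v \<in> V\<rbrakk> \<Longrightarrow> l\<^sub>\<rhd> (x \<lhd> y) v = l\<^sub>\<rhd> (x \<rhd> y) v"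

locale bimodule_algebra =
  V: assoc_algebra sV V mV + algebra_bimodule sA A mA sV V l r
  for sA :: "'f::field_char_0 \<Rightarrow> 'a::ab_group_add \<Rightarrow> 'a" and A and mA
    and sV :: "'f \<Rightarrow> 'v::ab_group_add \<Rightarrow> 'v" and V and mV (infixl "\<cdot>\<^sub>V" 70) and l r +
  assumes "\<lbrakk>x \<in> A; a \<in> V; b \<in> V\<rbrakk> \<Longrightarrow> l x (a \<cdot>\<^sub>V b) = l x a \<cdot>\<^sub>V b"
    and "\<lbrakk>x \<in> A; a \<in> V; b \<in> V\<rbrakk> \<Longrightarrow> r x (a \<cdot>\<^sub>V b) = a \<cdot>\<^sub>V r x b"
    and "\<lbrakk>x \<in> A; a \<in> V; b \<in> V\<rbrakk> \<Longrightarrow> r x a \<cdot>\<^sub>V b = a \<cdot>\<^sub>V l x b"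

locale bimodule_dialgebra =
  V: dialgebra sV V rhdV lhdV +
  dialgebra_bimodule sA A rhdA lhdA sV V lr rr ll rl +
  rhd: bimodule_algebra sA A rhdA sV V rhdV lr rr +
  lhd: bimodule_algebra sA A lhdA sV V lhdV ll rl
  for sA :: "'f::field_char_0 \<Rightarrow> 'a::ab_group_add \<Rightarrow> 'a" and A
    and rhdA (infixl "\<rhd>\<^sub>A" 70) and lhdA (infixl "\<lhd>\<^sub>A" 70)
    and sV :: "'f \<Rightarrow> 'v::ab_group_add \<Rightarrow> 'v" and V
    and rhdV (infixl "\<rhd>\<^sub>V" 70) and lhdV (infixl "\<lhd>\<^sub>V" 70)
    and lr ("l\<^sub>\<rhd>") and rr ("r\<^sub>\<rhd>") and ll ("l\<^sub>\<lhd>") and rl ("r\<^sub>\<lhd>") +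
  assumes "\<lbrakk>x \<in> A; a \<in> V; b \<in> V\<rbrakk> \<Longrightarrow> l\<^sub>\<lhd> x (a \<lhd>\<^sub>V b) = l\<^sub>\<lhd> x (a \<rhd>\<^sub>V b)"
    and "\<lbrakk>x \<in> A; a \<in> V; b \<in> V\<rbrakk> \<Longrightarrow> a \<lhd>\<^sub>V (l\<^sub>\<lhd> x b) = a \<lhd>\<^sub>V (l\<^sub>\<rhd> x b)"
    and "\<lbrakk>x \<in> A; a \<in> V; b \<in> V\<rbrakk> \<Longrightarrow> a \<lhd>\<^sub>V (r\<^sub>\<lhd> x b) = a \<lhd>\<^sub>V (r\<^sub>\<rhd> x b)"
    and "\<lbrakk>x \<in> A; a \<in> V; b \<in> V\<rbrakk> \<Longrightarrow> l\<^sub>\<rhd> x (a \<lhd>\<^sub>V b) = (l\<^sub>\<rhd> x a) \<lhd>\<^sub>V b"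
    and "\<lbrakk>x \<in> A; a \<in> V; b \<in> V\<rbrakk> \<Longrightarrow> (r\<^sub>\<rhd> x a) \<lhd>\<^sub>V b = a \<rhd>\<^sub>V (l\<^sub>\<lhd> x b)"
    and "\<lbrakk>x \<in> A; a \<in> V; b \<in> V\<rbrakk> \<Longrightarrow> r\<^sub>\<lhd> x (a \<rhd>\<^sub>V b) = a \<rhd>\<^sub>V (r\<^sub>\<lhd> x b)"
    and "\<lbrakk>x \<in> A; a \<in> V; b \<in> V\<rbrakk> \<Longrightarrow> (l\<^sub>\<lhd> x a) \<rhd>\<^sub>V b = (l\<^sub>\<rhd> x a) \<rhd>\<^sub>V b"
    and "\<lbrakk>x \<in> A; a \<in> V; b \<in> V\<rbrakk> \<Longrightarrow> (r\<^sub>\<lhd> x a) \<rhd>\<^sub>V b = (r\<^sub>\<rhd> x a) \<rhd>\<^sub>V b"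
    and "\<lbrakk>x \<in> A; a \<in> V; b \<in> V\<rbrakk> \<Longrightarrow> r\<^sub>\<rhd> x (a \<lhd>\<^sub>V b) = r\<^sub>\<rhd> x (a \<rhd>\<^sub>V b)"

locale O_operator =
  bimodule_dialgebra sA A rhdA lhdA sV V rhdV lhdV lr rr ll rl
  for sA :: "'f::field_char_0 \<Rightarrow> 'a::ab_group_add \<Rightarrow> 'a" and A
    and rhdA (infixl "\<rhd>\<^sub>A" 70) and lhdA (infixl "\<lhd>\<^sub>A" 70)
    and sV :: "'f \<Rightarrow> 'v::ab_group_add \<Rightarrow> 'v" and V
    and rhdV (infixl "\<rhd>\<^sub>V" 70) and lhdV (infixl "\<lhd>\<^sub>V" 70)
    and lr ("l\<^sub>\<rhd>") and rr ("r\<^sub>\<rhd>") and ll ("l\<^sub>\<lhd>") and rl ("r\<^sub>\<lhd>") +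
  fixes weight :: 'f and T :: "'v \<Rightarrow> 'a"
  assumes "linear_on sV V sA A T"
    and "\<lbrakk>a \<in> V; b \<in> V\<rbrakk> \<Longrightarrow>
      T a \<rhd>\<^sub>A T b = T (l\<^sub>\<rhd> (T a) b + r\<^sub>\<rhd> (T b) a + sV weight (a \<rhd>\<^sub>V b))"
    and "\<lbrakk>a \<in> V; b \<in> V\<rbrakk> \<Longrightarrow>
      T a \<lhd>\<^sub>A T b = T (l\<^sub>\<lhd> (T a) b + r\<^sub>\<lhd> (T b) a + sV weight (a \<lhd>\<^sub>V b))"

definition dual :: "('f::field \<Rightarrow> 'a::ab_group_add \<Rightarrow> 'a) \<Rightarrow> ('a \<Rightarrow> 'f) set" where
  "dual s = {u. Vector_Spaces.linear s (*) u}"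

definition dual_scale :: "'f::field \<Rightarrow> ('a \<Rightarrow> 'f) \<Rightarrow> ('a \<Rightarrow> 'f)" where
  "dual_scale c u = (\<lambda>x. c * u x)"

definition dual_map :: "('a \<Rightarrow> 'v \<Rightarrow> 'v) \<Rightarrow> 'a \<Rightarrow> ('v \<Rightarrow> 'f::field) \<Rightarrow> ('v \<Rightarrow> 'f)" where
  "dual_map \<phi> x u = (\<lambda>v. - u (\<phi> x v))"

text \<open>
  As A is finite-dimensional, its tensor square is identified with the bilinear forms on the dual
  space, with (a \<otimes> b)(u, v) = u(a) v(b), so that t u v is the pairing of t with u \<otimes> v; the tensor
  cube is treated in the same way. The forms are set to 0 outside the dual space, so that equality
  of tensors is equality of functions, and the elements of the tensor square are exactly the finite
  sums of pure tensors.
\<close>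

type_synonym ('a, 'f) tens2 = "('a \<Rightarrow> 'f) \<Rightarrow> ('a \<Rightarrow> 'f) \<Rightarrow> 'f"
type_synonym ('a, 'f) tens3 = "('a \<Rightarrow> 'f) \<Rightarrow> ('a \<Rightarrow> 'f) \<Rightarrow> ('a \<Rightarrow> 'f) \<Rightarrow> 'f"

definition on_dual2 ::
  "('f::field \<Rightarrow> 'a::ab_group_add \<Rightarrow> 'a) \<Rightarrow> ('a, 'f) tens2 \<Rightarrow> ('a, 'f) tens2" where
  "on_dual2 s t = (\<lambda>u v. if u \<in> dual s \<and> v \<in> dual s then t u v else 0)"

definition on_dual3 ::
  "('f::field \<Rightarrow> 'a::ab_group_add \<Rightarrow> 'a) \<Rightarrow> ('a, 'f) tens3 \<Rightarrow> ('a, 'f) tens3" where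
  "on_dual3 s t = (\<lambda>u v w. if u \<in> dual s \<and> v \<in> dual s \<and> w \<in> dual s then t u v w else 0)"

definition tensor ::
  "('f::field \<Rightarrow> 'a::ab_group_add \<Rightarrow> 'a) \<Rightarrow> 'a \<Rightarrow> 'a \<Rightarrow> ('a, 'f) tens2" where
  "tensor s a b = on_dual2 s (\<lambda>u v. u a * v b)"

definition tensor3 ::
  "('f::field \<Rightarrow> 'a::ab_group_add \<Rightarrow> 'a) \<Rightarrow> 'a \<Rightarrow> 'a \<Rightarrow> 'a \<Rightarrow> ('a, 'f) tens3" where
  "tensor3 s a b c = on_dual3 s (\<lambda>u v w. u a * v b * w c)"

definition tensor_square ::
  "('f::field \<Rightarrow> 'a::ab_group_add \<Rightarrow> 'a) \<Rightarrow> ('a, 'f) tens2 set" where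
  "tensor_square s = {t. \<exists>(n::nat) a b. t = (\<Sum>i<n. tensor s (a i) (b i))}"

definition tensor_scale :: "'f::field \<Rightarrow> ('a, 'f) tens2 \<Rightarrow> ('a, 'f) tens2" where
  "tensor_scale c t = (\<lambda>u v. c * t u v)"

definition flip :: "('a, 'f) tens2 \<Rightarrow> ('a, 'f) tens2"  ("\<tau>") where
  "\<tau> t = (\<lambda>u v. t v u)"

text \<open>The maps \<phi> \<otimes> \<psi>, id \<otimes> \<delta> and \<delta> \<otimes> id for linear \<phi>, \<psi>, \<delta>; see the lemmas below.\<close>

definition map_tensor ::
  "('f::field \<Rightarrow> 'a::ab_group_add \<Rightarrow> 'a) \<Rightarrow> ('a \<Rightarrow> 'a) \<Rightarrow> ('a \<Rightarrow> 'a)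
    \<Rightarrow> ('a, 'f) tens2 \<Rightarrow> ('a, 'f) tens2" where
  "map_tensor s \<phi> \<psi> t = on_dual2 s (\<lambda>u v. t (u \<circ> \<phi>) (v \<circ> \<psi>))"

definition id_tensor ::
  "('f::field \<Rightarrow> 'a::ab_group_add \<Rightarrow> 'a) \<Rightarrow> ('a \<Rightarrow> ('a, 'f) tens2)
    \<Rightarrow> ('a, 'f) tens2 \<Rightarrow> ('a, 'f) tens3" where
  "id_tensor s \<delta> t = on_dual3 s (\<lambda>u v w. t u (\<lambda>x. \<delta> x v w))"

definition tensor_id ::
  "('f::field \<Rightarrow> 'a::ab_group_add \<Rightarrow> 'a) \<Rightarrow> ('a \<Rightarrow> ('a, 'f) tens2)
    \<Rightarrow> ('a, 'f) tens2 \<Rightarrow> ('a, 'f) tens3" where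
  "tensor_id s \<delta> t = on_dual3 s (\<lambda>u v w. t (\<lambda>x. \<delta> x u v) w)"

lemma flip_tensor: "\<tau> (tensor s a b) = tensor s b a"
  by (auto simp: flip_def tensor_def on_dual2_def fun_eq_iff)

lemma map_tensor_add:
  "map_tensor s \<phi> \<psi> (t + t') = map_tensor s \<phi> \<psi> t + map_tensor s \<phi> \<psi> t'"
  by (auto simp: map_tensor_def on_dual2_def fun_eq_iff)

lemma map_tensor_tensor:
  assumes "Vector_Spaces.linear s s \<phi>" "Vector_Spaces.linear s s \<psi>"
  shows "map_tensor s \<phi> \<psi> (tensor s a b) = tensor s (\<phi> a) (\<psi> b)"
  using assms
  by (auto simp: map_tensor_def tensor_def on_dual2_def dual_def fun_eq_iff
      intro: Vector_Spaces.linear_compose)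

lemma coefficient_in_dual:
  assumes "vector_space s" "linear_on s UNIV tensor_scale (tensor_square s) \<delta>"
  shows "(\<lambda>x. \<delta> x u v) \<in> dual s"
  using assms
  by (auto simp: dual_def linear_on_def tensor_scale_def Vector_Spaces.linear_def
      module_hom_def module_hom_axioms_def vector_space_def module_def algebra_simps)

lemma id_tensor_tensor:
  assumes "vector_space s" "linear_on s UNIV tensor_scale (tensor_square s) \<delta>"
    and "u \<in> dual s" "v \<in> dual s" "w \<in> dual s"
  shows "id_tensor s \<delta> (tensor s a b) u v w = u a * \<delta> b v w"
  using assms coefficient_in_dual[OF assms(1,2)]
  by (auto simp: id_tensor_def on_dual3_def tensor_def on_dual2_def)

lemma tensor_id_tensor:
  assumes "vector_space s" "linear_on s UNIV tensor_scale (tensor_square s) \<delta>"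
    and "u \<in> dual s" "v \<in> dual s" "w \<in> dual s"
  shows "tensor_id s \<delta> (tensor s a b) u v w = \<delta> a u v * w b"
  using assms coefficient_in_dual[OF assms(1,2)]
  by (auto simp: tensor_id_def on_dual3_def tensor_def on_dual2_def)

text \<open>
  The two maps from the dual space to A induced by a tensor; existence and uniqueness of the value
  follow from finite dimension.
\<close>

definition tilde ::
  "('f::field \<Rightarrow> 'a::ab_group_add \<Rightarrow> 'a) \<Rightarrow> ('a, 'f) tens2 \<Rightarrow> ('a \<Rightarrow> 'f) \<Rightarrow> 'a" where
  "tilde s t u = (THE x. \<forall>v\<in>dual s. v x = t u v)"

definition tilde_t ::
  "('f::field \<Rightarrow> 'a::ab_group_add \<Rightarrow> 'a) \<Rightarrow> ('a, 'f) tens2 \<Rightarrow> ('a \<Rightarrow> 'f) \<Rightarrow> 'a" where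
  "tilde_t s t v = (THE x. \<forall>u\<in>dual s. u x = t u v)"

definition Lm :: "('a \<Rightarrow> 'a \<Rightarrow> 'a) \<Rightarrow> 'a \<Rightarrow> 'a \<Rightarrow> 'a" where
  "Lm m x y = m x y"

definition Rm :: "('a \<Rightarrow> 'a \<Rightarrow> 'a) \<Rightarrow> 'a \<Rightarrow> 'a \<Rightarrow> 'a" where
  "Rm m x y = m y x"

definition star ::
  "('a::ab_group_add \<Rightarrow> 'a \<Rightarrow> 'a) \<Rightarrow> ('a \<Rightarrow> 'a \<Rightarrow> 'a) \<Rightarrow> 'a \<Rightarrow> 'a \<Rightarrow> 'a" where
  "star rhd lhd x y = rhd x y - lhd x y"

locale codialgebra = fd_space scale UNIV
  for scale :: "'f::field_char_0 \<Rightarrow> 'a::ab_group_add \<Rightarrow> 'a" +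
  fixes \<delta>r :: "'a \<Rightarrow> ('a, 'f) tens2"  ("\<delta>\<^sub>\<rhd>")
    and \<delta>l :: "'a \<Rightarrow> ('a, 'f) tens2"  ("\<delta>\<^sub>\<lhd>")
  assumes "linear_on scale UNIV tensor_scale (tensor_square scale) \<delta>\<^sub>\<rhd>"
    and "linear_on scale UNIV tensor_scale (tensor_square scale) \<delta>\<^sub>\<lhd>"
    and "tensor_id scale \<delta>\<^sub>\<rhd> (\<delta>\<^sub>\<rhd> x) = id_tensor scale \<delta>\<^sub>\<rhd> (\<delta>\<^sub>\<rhd> x)"
    and "tensor_id scale \<delta>\<^sub>\<lhd> (\<delta>\<^sub>\<lhd> x) = id_tensor scale \<delta>\<^sub>\<lhd> (\<delta>\<^sub>\<lhd> x)"
    and "id_tensor scale \<delta>\<^sub>\<lhd> (\<delta>\<^sub>\<lhd> x) = id_tensor scale \<delta>\<^sub>\<rhd> (\<delta>\<^sub>\<lhd> x)"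
    and "tensor_id scale \<delta>\<^sub>\<rhd> (\<delta>\<^sub>\<lhd> x) = id_tensor scale \<delta>\<^sub>\<lhd> (\<delta>\<^sub>\<rhd> x)"
    and "tensor_id scale \<delta>\<^sub>\<lhd> (\<delta>\<^sub>\<rhd> x) = tensor_id scale \<delta>\<^sub>\<rhd> (\<delta>\<^sub>\<rhd> x)"

locale dialgebra_codialgebra =
  dialgebra scale UNIV rhd lhd + codialgebra scale \<delta>r \<delta>l
  for scale :: "'f::field_char_0 \<Rightarrow> 'a::ab_group_add \<Rightarrow> 'a"
    and rhd (infixl "\<rhd>" 70) and lhd (infixl "\<lhd>" 70)
    and \<delta>r :: "'a \<Rightarrow> ('a, 'f) tens2"  ("\<delta>\<^sub>\<rhd>")
    and \<delta>l :: "'a \<Rightarrow> ('a, 'f) tens2"  ("\<delta>\<^sub>\<lhd>")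
begin

abbreviation L_rhd ("L\<^sub>\<rhd>") where "L\<^sub>\<rhd> \<equiv> Lm rhd"
abbreviation R_rhd ("R\<^sub>\<rhd>") where "R\<^sub>\<rhd> \<equiv> Rm rhd"
abbreviation L_lhd ("L\<^sub>\<lhd>") where "L\<^sub>\<lhd> \<equiv> Lm lhd"
abbreviation R_lhd ("R\<^sub>\<lhd>") where "R\<^sub>\<lhd> \<equiv> Rm lhd"
abbreviation L_star ("L\<^sub>\<star>") where "L\<^sub>\<star> \<equiv> Lm (star rhd lhd)"
abbreviation R_star ("R\<^sub>\<star>") where "R\<^sub>\<star> \<equiv> Rm (star rhd lhd)"
abbreviation delta_star ("\<delta>\<^sub>\<star>") where "\<delta>\<^sub>\<star> x \<equiv> \<delta>\<^sub>\<rhd> x - \<delta>\<^sub>\<lhd> x"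
abbreviation on_fst :: "('a \<Rightarrow> 'a) \<Rightarrow> ('a, 'f) tens2 \<Rightarrow> ('a, 'f) tens2"  ("_ \<otimes>id" [1000] 1000)
  where "\<phi> \<otimes>id \<equiv> map_tensor scale \<phi> id"
abbreviation on_snd :: "('a \<Rightarrow> 'a) \<Rightarrow> ('a, 'f) tens2 \<Rightarrow> ('a, 'f) tens2"  ("id\<otimes> _" [1000] 1000)
  where "id\<otimes> \<phi> \<equiv> map_tensor scale id \<phi>"

end

locale bi_dialgebra = dialgebra_codialgebra +
  assumes "(id\<otimes> (L\<^sub>\<lhd> x)) (\<delta>\<^sub>\<lhd> y) = ((R\<^sub>\<rhd> y) \<otimes>id) (\<delta>\<^sub>\<rhd> x)"
    and "((L\<^sub>\<lhd> x) \<otimes>id) (\<delta>\<^sub>\<rhd> y) = (id\<otimes> (L\<^sub>\<lhd> y)) (\<tau> (\<delta>\<^sub>\<rhd> x))"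
    and "((R\<^sub>\<rhd> x) \<otimes>id) (\<tau> (\<delta>\<^sub>\<lhd> y)) = (id\<otimes> (R\<^sub>\<rhd> y)) (\<delta>\<^sub>\<lhd> x)"
    and "\<delta>\<^sub>\<rhd> (x \<rhd> y) = (id\<otimes> (L\<^sub>\<rhd> x)) (\<delta>\<^sub>\<rhd> y) - ((R\<^sub>\<star> y) \<otimes>id) (\<delta>\<^sub>\<star> x)"
    and "\<delta>\<^sub>\<rhd> (x \<lhd> y) = (id\<otimes> (L\<^sub>\<lhd> x)) (\<delta>\<^sub>\<star> y) + ((R\<^sub>\<lhd> y) \<otimes>id) (\<delta>\<^sub>\<rhd> x)"
    and "\<delta>\<^sub>\<lhd> (x \<rhd> y) = (id\<otimes> (L\<^sub>\<star> x)) (\<delta>\<^sub>\<lhd> y) + ((R\<^sub>\<rhd> y) \<otimes>id) (\<delta>\<^sub>\<lhd> x)"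
    and "\<delta>\<^sub>\<lhd> (x \<lhd> y) = ((R\<^sub>\<lhd> y) \<otimes>id) (\<delta>\<^sub>\<lhd> x) - (id\<otimes> (L\<^sub>\<star> x)) (\<delta>\<^sub>\<star> y)"
    and "((L\<^sub>\<star> x) \<otimes>id) (\<delta>\<^sub>\<rhd> y) + (id\<otimes> (L\<^sub>\<lhd> y)) (\<tau> (\<delta>\<^sub>\<lhd> x)) =
         ((R\<^sub>\<star> y) \<otimes>id) (\<tau> (\<delta>\<^sub>\<star> x)) + (id\<otimes> (R\<^sub>\<lhd> x)) (\<delta>\<^sub>\<rhd> y)"
    and "((R\<^sub>\<lhd> x) \<otimes>id) (\<tau> (\<delta>\<^sub>\<lhd> y)) + (id\<otimes> (R\<^sub>\<rhd> y)) (\<delta>\<^sub>\<star> x) =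
         ((L\<^sub>\<star> y) \<otimes>id) (\<delta>\<^sub>\<star> x) + (id\<otimes> (L\<^sub>\<rhd> x)) (\<tau> (\<delta>\<^sub>\<lhd> y))"

definition invariant ::
  "('f::field \<Rightarrow> 'a::ab_group_add \<Rightarrow> 'a) \<Rightarrow> ('a \<Rightarrow> 'a \<Rightarrow> 'a) \<Rightarrow> ('a \<Rightarrow> 'a \<Rightarrow> 'a)
    \<Rightarrow> ('a, 'f) tens2 \<Rightarrow> bool" where
  "invariant s rhd lhd t \<longleftrightarrow> (\<forall>x.
     map_tensor s (Rm (star rhd lhd) x) id t + map_tensor s id (Lm lhd x) t = 0 \<and>
     map_tensor s (Rm rhd x) id t - map_tensor s id (Lm (star rhd lhd) x) t = 0)"

text \<open>The left-hand side of the equation does not depend on the chosen decomposition of t.\<close>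

definition solves_DAYBE ::
  "('f::field \<Rightarrow> 'a::ab_group_add \<Rightarrow> 'a) \<Rightarrow> ('a \<Rightarrow> 'a \<Rightarrow> 'a) \<Rightarrow> ('a \<Rightarrow> 'a \<Rightarrow> 'a)
    \<Rightarrow> ('a, 'f) tens2 \<Rightarrow> bool" where
  "solves_DAYBE s rhd lhd t \<longleftrightarrow> (\<exists>(n::nat) a b.
     t = (\<Sum>i<n. tensor s (a i) (b i)) \<and>
     (\<Sum>i<n. \<Sum>j<n.
        tensor3 s (a i) (a j) (rhd (b i) (b j))
      - tensor3 s (a j) (lhd (a i) (b j)) (b i)
      - tensor3 s (star rhd lhd (a i) (a j)) (b i) (b j)) = 0)"

definition skew_part :: "('a, 'f::field) tens2 \<Rightarrow> ('a, 'f) tens2" where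
  "skew_part t = t - \<tau> t"

definition delta_rhd ::
  "('f::field \<Rightarrow> 'a::ab_group_add \<Rightarrow> 'a) \<Rightarrow> ('a \<Rightarrow> 'a \<Rightarrow> 'a) \<Rightarrow> ('a \<Rightarrow> 'a \<Rightarrow> 'a)
    \<Rightarrow> ('a, 'f) tens2 \<Rightarrow> 'a \<Rightarrow> ('a, 'f) tens2" where
  "delta_rhd s rhd lhd t x =
     map_tensor s (Rm (star rhd lhd) x) id t + map_tensor s id (Lm lhd x) t"

definition delta_lhd ::
  "('f::field \<Rightarrow> 'a::ab_group_add \<Rightarrow> 'a) \<Rightarrow> ('a \<Rightarrow> 'a \<Rightarrow> 'a) \<Rightarrow> ('a \<Rightarrow> 'a \<Rightarrow> 'a)
    \<Rightarrow> ('a, 'f) tens2 \<Rightarrow> 'a \<Rightarrow> ('a, 'f) tens2" where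
  "delta_lhd s rhd lhd t x =
     map_tensor s (Rm rhd x) id t - map_tensor s id (Lm (star rhd lhd) x) t"

definition quasi_triangular ::
  "('f::field_char_0 \<Rightarrow> 'a::ab_group_add \<Rightarrow> 'a) \<Rightarrow> ('a \<Rightarrow> 'a \<Rightarrow> 'a) \<Rightarrow> ('a \<Rightarrow> 'a \<Rightarrow> 'a)
    \<Rightarrow> ('a, 'f) tens2 \<Rightarrow> bool" where
  "quasi_triangular s rhd lhd t \<longleftrightarrow>
     solves_DAYBE s rhd lhd t \<and> invariant s rhd lhd (skew_part t) \<and>
     bi_dialgebra s rhd lhd (delta_rhd s rhd lhd t) (delta_lhd s rhd lhd t)"

definition rhd_dual ::
  "('f::field \<Rightarrow> 'a::ab_group_add \<Rightarrow> 'a) \<Rightarrow> ('a \<Rightarrow> 'a \<Rightarrow> 'a) \<Rightarrow> ('a \<Rightarrow> 'a \<Rightarrow> 'a)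
    \<Rightarrow> ('a, 'f) tens2 \<Rightarrow> ('a \<Rightarrow> 'f) \<Rightarrow> ('a \<Rightarrow> 'f) \<Rightarrow> ('a \<Rightarrow> 'f)" where
  "rhd_dual s rhd lhd t u v = dual_map (Lm (star rhd lhd)) (tilde s (skew_part t) v) u"

definition lhd_dual ::
  "('f::field \<Rightarrow> 'a::ab_group_add \<Rightarrow> 'a) \<Rightarrow> ('a \<Rightarrow> 'a \<Rightarrow> 'a)
    \<Rightarrow> ('a, 'f) tens2 \<Rightarrow> ('a \<Rightarrow> 'f) \<Rightarrow> ('a \<Rightarrow> 'f) \<Rightarrow> ('a \<Rightarrow> 'f)" where
  "lhd_dual s rhd t u v = dual_map (Lm rhd) (tilde s (skew_part t) v) u"

end

theory Submission
  imports Defs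
begin

text \<open>
  Write R and Rt for the two maps induced by r. Invariance says exactly that P = R - Rt is a morphism
  of bimodules from the dual space to A. The coproducts of r are dual to two products on the dual
  space, and the equations of an O-operator of weight 1 (resp. -1) say that R (resp. Rt) is
  multiplicative for these; since P is a bimodule morphism, R is multiplicative on a given pair if
  and only if Rt is. Paired with a third functional, the DAYBE is the multiplicativity of R for the
  first product, and the multiplicativity of R for the second product is that of Rt for the first
  one with the arguments permuted cyclically. If R and Rt are multiplicative, the co-dialgebra axioms
  are dual to the dialgebra axioms of the two products, which follow from the bimodule axioms; the
  remaining bi-dialgebra axioms need invariance only.
\<close>

section \<open>Linear functionals on a finite-dimensional space\<close>

lemma vector_space_times: "vector_space ((*) :: 'f::field \<Rightarrow> 'f \<Rightarrow> 'f)"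
  by unfold_locales (simp_all add: algebra_simps)

lemma sum_apply: "(\<Sum>i\<in>I. f i) x = (\<Sum>i\<in>I. f i x)"
  by (induction I rule: infinite_finite_induct) auto

lemma (in vector_space) mem_dual_iff:
  "u \<in> dual scale \<longleftrightarrow> (\<forall>x y. u (x + y) = u x + u y) \<and> (\<forall>c x. u (scale c x) = c * u x)"
proof -
  interpret times: vector_space "(*) :: 'a \<Rightarrow> 'a \<Rightarrow> 'a"
    by (rule vector_space_times)
  show ?thesis
    using vector_space_axioms times.vector_space_axioms module_axioms times.module_axioms
    by (auto simp: dual_def Vector_Spaces.linear_def module_hom_def module_hom_axioms_def)
qed

locale fd_type = fd_space scale UNIV
  for scale :: "'f::field_char_0 \<Rightarrow> 'a::ab_group_add \<Rightarrow> 'a"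
begin

abbreviation D :: "('a \<Rightarrow> 'f) set" where "D \<equiv> dual scale"

lemma dual_add: "u \<in> D \<Longrightarrow> u (x + y) = u x + u y"
  and dual_homogeneous: "u \<in> D \<Longrightarrow> u (scale c x) = c * u x"
  by (simp_all add: mem_dual_iff)

lemma dual_zero: "u \<in> D \<Longrightarrow> u 0 = 0"
  using dual_add[of u 0 0] by simp

lemma dual_uminus: "u \<in> D \<Longrightarrow> u (- x) = - u x"
  using dual_add[of u x "- x"] dual_zero[of u] by (simp add: eq_neg_iff_add_eq_0 add.commute)

lemma dual_diff: "u \<in> D \<Longrightarrow> u (x - y) = u x - u y"
  using dual_add[of u x "- y"] by (simp add: dual_uminus)

lemma dual_sum: "u \<in> D \<Longrightarrow> u (\<Sum>i\<in>I. f i) = (\<Sum>i\<in>I. u (f i))"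
  by (induction I rule: infinite_finite_induct) (auto simp: dual_add dual_zero)

lemmas dual_linear = dual_add dual_homogeneous dual_zero dual_uminus dual_diff

lemma zero_in_dual: "0 \<in> D"
  and add_in_dual: "u \<in> D \<Longrightarrow> v \<in> D \<Longrightarrow> u + v \<in> D"
  and uminus_in_dual: "u \<in> D \<Longrightarrow> - u \<in> D"
  and diff_in_dual: "u \<in> D \<Longrightarrow> v \<in> D \<Longrightarrow> u - v \<in> D"
  and scale_in_dual: "u \<in> D \<Longrightarrow> dual_scale c u \<in> D"
  by (auto simp: mem_dual_iff dual_scale_def algebra_simps)

lemmas in_dual = zero_in_dual add_in_dual uminus_in_dual diff_in_dual scale_in_dual

lemma vector_space_dual_scale: "vector_space (dual_scale :: 'f \<Rightarrow> ('a \<Rightarrow> 'f) \<Rightarrow> _)"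
  by unfold_locales (auto simp: dual_scale_def algebra_simps)

text \<open>A nonzero vector is independent on its own, so some functional takes the value 1 at it.
  Every identity between vectors can therefore be tested against functionals.\<close>

lemma dual_separates:
  assumes "\<And>u. u \<in> D \<Longrightarrow> u x = u y"
  shows "x = y"
proof (rule ccontr)
  assume "x \<noteq> y"
  interpret times: vector_space "(*) :: 'f \<Rightarrow> 'f \<Rightarrow> 'f"
    by (rule vector_space_times)
  interpret pair: vector_space_pair scale "(*) :: 'f \<Rightarrow> 'f \<Rightarrow> 'f" ..
  have "independent {x - y}"
    using \<open>x \<noteq> y\<close> by (simp add: dependent_single)
  from pair.linear_independent_extend[OF this, of "\<lambda>_. 1"]
  obtain u where "u \<in> D" "u (x - y) = 1"
    by (auto simp: dual_def)
  then show False
    using assms[of u] by (simp add: dual_diff)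
qed

text \<open>A basis inside a finite spanning set has finitely many coordinate functionals, and a
  functional \<open>u\<close> is their combination with coefficients \<open>u b\<close>.\<close>

lemma fd_space_dual: "fd_space dual_scale D"
proof -
  interpret dual: vector_space "dual_scale :: 'f \<Rightarrow> ('a \<Rightarrow> 'f) \<Rightarrow> _"
    by (rule vector_space_dual_scale)
  obtain S where S: "finite S" "span S = UNIV"
    using finite_dim by auto
  obtain B where B: "B \<subseteq> S" "independent B" "S \<subseteq> span B"
    by (rule maximal_independent_subset)
  have span_B: "span B = UNIV"
    using span_mono[OF B(3)] S(2) by (simp add: span_span top.extremum_unique)
  have "finite B"
    using B(1) S(1) finite_subset by blast
  define coord where "coord = (\<lambda>b x. representation B x b)"
  have coord: "coord b \<in> D" for b
    using B(2) span_B
    by (auto simp: mem_dual_iff coord_def representation_add representation_scale)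
  have "dual.span (coord ` B) = D"
  proof
    have "dual.subspace D"
      by (auto simp: dual.subspace_def intro: in_dual)
    then show "dual.span (coord ` B) \<subseteq> D"
      using coord by (intro dual.span_minimal) auto
    show "D \<subseteq> dual.span (coord ` B)"
    proof
      fix u assume u: "u \<in> D"
      have "u x = (\<Sum>b\<in>B. dual_scale (u b) (coord b)) x" for x
      proof -
        have "u x = u (\<Sum>b\<in>B. scale (coord b x) b)"
          using sum_representation_eq[OF B(2) _ \<open>finite B\<close> order_refl, of x] span_B
          by (simp add: coord_def)
        then show ?thesis
          using u by (simp add: dual_sum dual_homogeneous sum_apply dual_scale_def mult.commute)
      qed
      then have "u = (\<Sum>b\<in>B. dual_scale (u b) (coord b))"
        by (rule ext)
      also have "\<dots> \<in> dual.span (coord ` B)"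
        by (intro dual.span_sum dual.span_scale dual.span_base) auto
      finally show "u \<in> dual.span (coord ` B)" .
    qed
  qed
  then show ?thesis
    using \<open>finite B\<close> by unfold_locales blast
qed

subsection \<open>Tensors\<close>

abbreviation T2 :: "('a, 'f) tens2 set" where "T2 \<equiv> tensor_square scale"

lemma tensor_sum_eval:
  assumes "u \<in> D" "v \<in> D"
  shows "(\<Sum>i\<in>I. tensor scale (a i) (b i)) u v = (\<Sum>i\<in>I. u (a i) * v (b i))"
  using assms by (simp add: sum_apply tensor_def on_dual2_def)

lemma tensor_sum_in_tensor_square: "(\<Sum>i<n::nat. tensor scale (a i) (b i)) \<in> T2"
  unfolding tensor_square_def by blast

text \<open>Two decompositions into pure tensors are concatenated, with the indices of the second
  shifted by \<open>n\<close>.\<close>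

lemma tensor_square_add:
  assumes "t \<in> T2" "t' \<in> T2"
  shows "t + t' \<in> T2"
proof -
  obtain n a b where t: "t = (\<Sum>i<n::nat. tensor scale (a i) (b i))"
    using assms(1) by (auto simp: tensor_square_def)
  obtain n' a' b' where t': "t' = (\<Sum>i<n'::nat. tensor scale (a' i) (b' i))"
    using assms(2) by (auto simp: tensor_square_def)
  define a'' b'' where "a'' = (\<lambda>i. if i < n then a i else a' (i - n))"
    and "b'' = (\<lambda>i. if i < n then b i else b' (i - n))"
  have "(\<Sum>i<n + n'. tensor scale (a'' i) (b'' i)) =
      (\<Sum>i<n. tensor scale (a'' i) (b'' i)) + (\<Sum>i<n'. tensor scale (a'' (n + i)) (b'' (n + i)))"
    by (induction n') (auto simp: add.assoc)
  also have "\<dots> = t + t'"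
    by (simp add: t t' a''_def b''_def)
  finally show ?thesis
    by (metis tensor_sum_in_tensor_square)
qed

lemma map_tensor_in_tensor_square:
  assumes "Vector_Spaces.linear scale scale \<phi>" "Vector_Spaces.linear scale scale \<psi>" "t \<in> T2"
  shows "map_tensor scale \<phi> \<psi> t \<in> T2"
proof -
  obtain n a b where t: "t = (\<Sum>i<n::nat. tensor scale (a i) (b i))"
    using assms(3) by (auto simp: tensor_square_def)
  have "map_tensor scale \<phi> \<psi> 0 = 0"
    by (auto simp: map_tensor_def on_dual2_def fun_eq_iff)
  then have "map_tensor scale \<phi> \<psi> t = (\<Sum>i<n. map_tensor scale \<phi> \<psi> (tensor scale (a i) (b i)))"
    unfolding t by (induction n) (auto simp: map_tensor_add)
  also have "\<dots> = (\<Sum>i<n. tensor scale (\<phi> (a i)) (\<psi> (b i)))"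
    using assms(1,2) by (simp add: map_tensor_tensor)
  finally show ?thesis
    by (simp add: tensor_sum_in_tensor_square)
qed

lemma tensor_square_uminus:
  assumes "t \<in> T2"
  shows "- t \<in> T2"
proof -
  obtain n a b where t: "t = (\<Sum>i<n::nat. tensor scale (a i) (b i))"
    using assms by (auto simp: tensor_square_def)
  have "tensor scale (- x) y = - tensor scale x y" for x y
    by (auto simp: tensor_def on_dual2_def fun_eq_iff dual_linear)
  then have "- t = (\<Sum>i<n. tensor scale (- a i) (b i))"
    by (simp add: t sum_negf)
  then show ?thesis
    by (simp add: tensor_sum_in_tensor_square)
qed

lemma tensor_square_diff: "t \<in> T2 \<Longrightarrow> t' \<in> T2 \<Longrightarrow> t - t' \<in> T2"
  using tensor_square_add[OF _ tensor_square_uminus, of t t'] by simp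

lemma flip_sum: "\<tau> (\<Sum>i\<in>I. tensor scale (a i) (b i)) = (\<Sum>i\<in>I. tensor scale (b i) (a i))"
proof -
  have "\<tau> (\<Sum>i\<in>I. tensor scale (a i) (b i)) = (\<Sum>i\<in>I. \<tau> (tensor scale (a i) (b i)))"
    by (simp add: flip_def fun_eq_iff sum_apply)
  then show ?thesis
    by (simp add: flip_tensor)
qed

lemma flip_in_tensor_square: "t \<in> T2 \<Longrightarrow> \<tau> t \<in> T2"
  unfolding tensor_square_def using flip_sum by blast

text \<open>A decomposition into pure tensors supplies the vector that the definite description asks
  for; \<open>dual_separates\<close> makes it unique.\<close>

lemma tilde_sum:
  assumes "u \<in> D"
  shows "tilde scale (\<Sum>i\<in>I. tensor scale (a i) (b i)) u = (\<Sum>i\<in>I. scale (u (a i)) (b i))"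
  unfolding tilde_def
proof (rule the_equality)
  show *: "\<forall>v\<in>D. v (\<Sum>i\<in>I. scale (u (a i)) (b i)) = (\<Sum>i\<in>I. tensor scale (a i) (b i)) u v"
    using assms by (simp add: dual_sum dual_homogeneous tensor_sum_eval)
  show "x = (\<Sum>i\<in>I. scale (u (a i)) (b i))"
    if "\<forall>v\<in>D. v x = (\<Sum>i\<in>I. tensor scale (a i) (b i)) u v" for x
    using that * by (intro dual_separates) metis
qed

lemma tilde_t_eq_tilde_flip: "tilde_t scale t = tilde scale (\<tau> t)"
  by (simp add: tilde_def tilde_t_def flip_def fun_eq_iff)

lemma tilde_eval:
  assumes "t \<in> T2" "u \<in> D" "v \<in> D"
  shows "v (tilde scale t u) = t u v"
  using assms by (auto simp: tensor_square_def tilde_sum tensor_sum_eval dual_sum dual_homogeneous)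

lemma tilde_t_eval:
  assumes "t \<in> T2" "u \<in> D" "v \<in> D"
  shows "u (tilde_t scale t v) = t u v"
  using tilde_eval[OF flip_in_tensor_square[OF assms(1)] assms(3,2)]
  by (simp add: tilde_t_eq_tilde_flip flip_def)

text \<open>With the second argument \<open>w\<close> fixed, the form is evaluation at the vector
  \<open>tilde_t scale t w\<close>, and functionals are added and scaled pointwise.\<close>

lemma tensor_linear_left:
  assumes "t \<in> T2" "u \<in> D" "v \<in> D" "w \<in> D"
  shows "t (u + v) w = t u w + t v w" "t (u - v) w = t u w - t v w" "t (- u) w = - t u w"
    "t (dual_scale c u) w = c * t u w" "t 0 w = 0"
  using assms by (simp_all flip: tilde_t_eval add: in_dual) (simp add: dual_scale_def)

lemma tensor_linear_right:
  assumes "t \<in> T2" "u \<in> D" "v \<in> D" "w \<in> D"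
  shows "t w (u + v) = t w u + t w v" "t w (u - v) = t w u - t w v" "t w (- u) = - t w u"
    "t w (dual_scale c u) = c * t w u" "t w 0 = 0"
  using assms by (simp_all flip: tilde_eval add: in_dual) (simp add: dual_scale_def)

lemmas tensor_bilinear = tensor_linear_left tensor_linear_right

lemma tilde_linear:
  assumes "t \<in> T2" "u \<in> D" "v \<in> D"
  shows "tilde scale t (u + v) = tilde scale t u + tilde scale t v"
    "tilde scale t (u - v) = tilde scale t u - tilde scale t v"
    "tilde scale t (- u) = - tilde scale t u"
    "tilde scale t (dual_scale c u) = scale c (tilde scale t u)"
    "tilde scale t 0 = 0"
  using assms
  by (auto intro!: dual_separates simp: dual_linear in_dual tilde_eval tensor_bilinear)

lemma skew_part_in_tensor_square: "t \<in> T2 \<Longrightarrow> skew_part t \<in> T2"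
  by (simp add: skew_part_def tensor_square_diff flip_in_tensor_square)

lemma tilde_skew_part:
  assumes "t \<in> T2" "u \<in> D"
  shows "tilde scale (skew_part t) u = tilde scale t u - tilde_t scale t u"
  using assms
  by (auto intro!: dual_separates
      simp: dual_linear skew_part_in_tensor_square tilde_eval tilde_t_eval)
     (simp add: skew_part_def flip_def)

lemma bilinear_sums:
  assumes m: "bilinear_on scale UNIV scale UNIV scale UNIV m" and "w \<in> D"
  shows "w (m (\<Sum>i\<in>I. scale (c i) (x i)) (\<Sum>j\<in>J. scale (d j) (y j))) =
    (\<Sum>i\<in>I. \<Sum>j\<in>J. c i * d j * w (m (x i) (y j)))"
proof -
  have left: "m (\<Sum>i\<in>I. scale (c i) (x i)) z = (\<Sum>i\<in>I. scale (c i) (m (x i) z))" for z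
  proof -
    have add: "m (a + b) z = m a z + m b z" and scale: "m (scale k a) z = scale k (m a z)" for a b k
      using m by (auto simp: bilinear_on_def linear_on_def)
    have "m 0 z = 0"
      using scale[of 0 0] by simp
    then show ?thesis
      by (induction I rule: infinite_finite_induct) (auto simp: add scale)
  qed
  have right: "m z (\<Sum>j\<in>J. scale (d j) (y j)) = (\<Sum>j\<in>J. scale (d j) (m z (y j)))" for z
  proof -
    have add: "m z (a + b) = m z a + m z b" and scale: "m z (scale k a) = scale k (m z a)" for a b k
      using m by (auto simp: bilinear_on_def linear_on_def)
    have "m z 0 = 0"
      using scale[of 0 0] by simp
    then show ?thesis
      by (induction J rule: infinite_finite_induct) (auto simp: add scale)
  qed
  have "w (m (\<Sum>i\<in>I. scale (c i) (x i)) (\<Sum>j\<in>J. scale (d j) (y j))) =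
      (\<Sum>i\<in>I. c i * (\<Sum>j\<in>J. d j * w (m (x i) (y j))))"
    unfolding left using \<open>w \<in> D\<close> by (simp only: right dual_sum dual_homogeneous)
  then show ?thesis
    by (simp add: sum_distrib_left mult.assoc)
qed

end

section \<open>Rewriting of products in a dialgebra\<close>

locale full_dialgebra = fd_type scale + dialgebra scale UNIV rhd lhd
  for scale :: "'f::field_char_0 \<Rightarrow> 'a::ab_group_add \<Rightarrow> 'a"
    and rhd (infixl "\<rhd>" 70) and lhd (infixl "\<lhd>" 70)
begin

abbreviation star_product (infixl "\<star>" 70) where "x \<star> y \<equiv> star rhd lhd x y"

lemma product_add:
  "(x + y) \<rhd> z = x \<rhd> z + y \<rhd> z" "z \<rhd> (x + y) = z \<rhd> x + z \<rhd> y"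
  "(x + y) \<lhd> z = x \<lhd> z + y \<lhd> z" "z \<lhd> (x + y) = z \<lhd> x + z \<lhd> y"
  and product_scale:
  "scale c x \<rhd> z = scale c (x \<rhd> z)" "z \<rhd> scale c x = scale c (z \<rhd> x)"
  "scale c x \<lhd> z = scale c (x \<lhd> z)" "z \<lhd> scale c x = scale c (z \<lhd> x)"
  using rhd.bilinear lhd.bilinear by (simp_all add: bilinear_on_def linear_on_def)

lemma product_zero: "0 \<rhd> z = 0" "z \<rhd> 0 = 0" "0 \<lhd> z = 0" "z \<lhd> 0 = 0"
  using product_scale(1)[of 0 0] product_scale(2)[of z 0 0]
    product_scale(3)[of 0 0] product_scale(4)[of z 0 0] by simp_all

lemma product_uminus:
  "(- x) \<rhd> z = - (x \<rhd> z)" "z \<rhd> (- x) = - (z \<rhd> x)"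
  "(- x) \<lhd> z = - (x \<lhd> z)" "z \<lhd> (- x) = - (z \<lhd> x)"
  using product_add(1)[of x "- x" z] product_add(2)[of z x "- x"]
    product_add(3)[of x "- x" z] product_add(4)[of z x "- x"]
  by (simp_all add: product_zero eq_neg_iff_add_eq_0 add.commute)

lemma product_diff:
  "(x - y) \<rhd> z = x \<rhd> z - y \<rhd> z" "z \<rhd> (x - y) = z \<rhd> x - z \<rhd> y"
  "(x - y) \<lhd> z = x \<lhd> z - y \<lhd> z" "z \<lhd> (x - y) = z \<lhd> x - z \<lhd> y"
  using product_add(1)[of x "- y" z] product_add(2)[of z x "- y"]
    product_add(3)[of x "- y" z] product_add(4)[of z x "- y"]
  by (simp_all add: product_uminus)

lemmas product_linear = product_add product_scale product_zero product_uminus product_diff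

lemma bilinear_star: "bilinear_on scale UNIV scale UNIV scale UNIV (\<star>)"
  by (simp add: bilinear_on_def linear_on_def star_def product_linear scale_right_diff_distrib)

text \<open>Oriented as rewrite rules: a product of three factors ends in one of the forms
  \<open>x \<rhd> (y \<rhd> z)\<close>, \<open>x \<rhd> (y \<lhd> z)\<close> and
  \<open>x \<lhd> (y \<lhd> z)\<close>, one for each choice of the central factor of a dialgebra
  monomial.\<close>

lemma product_assoc:
  "(x \<rhd> y) \<rhd> z = x \<rhd> (y \<rhd> z)" "(x \<lhd> y) \<rhd> z = x \<rhd> (y \<rhd> z)"
  "(x \<lhd> y) \<lhd> z = x \<lhd> (y \<lhd> z)" "x \<lhd> (y \<rhd> z) = x \<lhd> (y \<lhd> z)"
  "(x \<rhd> y) \<lhd> z = x \<rhd> (y \<lhd> z)"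
  by (simp_all add: rhd.assoc lhd.assoc lhd_lhd[symmetric] rhd_lhd lhd_rhd)

lemma linear_multiplication:
  "Vector_Spaces.linear scale scale (Lm rhd x)" "Vector_Spaces.linear scale scale (Lm lhd x)"
  "Vector_Spaces.linear scale scale (Lm (\<star>) x)" "Vector_Spaces.linear scale scale (Rm rhd x)"
  "Vector_Spaces.linear scale scale (Rm lhd x)" "Vector_Spaces.linear scale scale (Rm (\<star>) x)"
  "Vector_Spaces.linear scale scale id"
  using vector_space_axioms module_axioms
  by (auto simp: Vector_Spaces.linear_def module_hom_def module_hom_axioms_def Lm_def Rm_def
      star_def product_linear scale_right_diff_distrib)

subsection \<open>Transposed multiplications\<close>

text \<open>Transposes of the one-sided multiplications, without the sign of
  \<open>dual_map\<close>. The capital letter is the side, the last letter the product. As separate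
  constants they turn identities between functionals into rewriting of operators.\<close>

definition tRr where "tRr x u = (\<lambda>z. u (z \<rhd> x))" for u :: "'a \<Rightarrow> 'f"
definition tRl where "tRl x u = (\<lambda>z. u (z \<lhd> x))" for u :: "'a \<Rightarrow> 'f"
definition tLr where "tLr x u = (\<lambda>z. u (x \<rhd> z))" for u :: "'a \<Rightarrow> 'f"
definition tLl where "tLl x u = (\<lambda>z. u (x \<lhd> z))" for u :: "'a \<Rightarrow> 'f"

lemmas transpose_defs = tRr_def tRl_def tLr_def tLl_def

lemma transpose_in_dual:
  "u \<in> D \<Longrightarrow> tRr x u \<in> D" "u \<in> D \<Longrightarrow> tRl x u \<in> D" "u \<in> D \<Longrightarrow> tLr x u \<in> D" "u \<in> D \<Longrightarrow> tLl x u \<in> D"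
  by (simp_all add: mem_dual_iff transpose_defs product_linear)

lemma transpose_linear:
  "tRr x (u + v) = tRr x u + tRr x v" "tRr x (u - v) = tRr x u - tRr x v"
  "tRr x (- u) = - tRr x u" "tRr x (dual_scale c u) = dual_scale c (tRr x u)"
  "tRl x (u + v) = tRl x u + tRl x v" "tRl x (u - v) = tRl x u - tRl x v"
  "tRl x (- u) = - tRl x u" "tRl x (dual_scale c u) = dual_scale c (tRl x u)"
  "tLr x (u + v) = tLr x u + tLr x v" "tLr x (u - v) = tLr x u - tLr x v"
  "tLr x (- u) = - tLr x u" "tLr x (dual_scale c u) = dual_scale c (tLr x u)"
  "tLl x (u + v) = tLl x u + tLl x v" "tLl x (u - v) = tLl x u - tLl x v"
  "tLl x (- u) = - tLl x u" "tLl x (dual_scale c u) = dual_scale c (tLl x u)"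
  by (simp_all add: transpose_defs dual_scale_def fun_eq_iff)

lemma transpose_linear_arg:
  assumes "u \<in> D"
  shows "tRr (x + y) u = tRr x u + tRr y u" "tRr (x - y) u = tRr x u - tRr y u"
    "tRr (- x) u = - tRr x u" "tRr (scale c x) u = dual_scale c (tRr x u)"
    "tRl (x + y) u = tRl x u + tRl y u" "tRl (x - y) u = tRl x u - tRl y u"
    "tRl (- x) u = - tRl x u" "tRl (scale c x) u = dual_scale c (tRl x u)"
    "tLr (x + y) u = tLr x u + tLr y u" "tLr (x - y) u = tLr x u - tLr y u"
    "tLr (- x) u = - tLr x u" "tLr (scale c x) u = dual_scale c (tLr x u)"
    "tLl (x + y) u = tLl x u + tLl y u" "tLl (x - y) u = tLl x u - tLl y u"
    "tLl (- x) u = - tLl x u" "tLl (scale c x) u = dual_scale c (tLl x u)"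
  using assms
  by (simp_all add: transpose_defs dual_scale_def fun_eq_iff dual_linear product_linear)

lemma transpose_product:
  "tRr (x \<rhd> y) u = tRr x (tRr y u)" "tRr (x \<lhd> y) u = tRr x (tRl y u)"
  "tRl (x \<rhd> y) u = tRl x (tRl y u)" "tRl (x \<lhd> y) u = tRl x (tRl y u)"
  "tLr (x \<rhd> y) u = tLr y (tLr x u)" "tLr (x \<lhd> y) u = tLr y (tLr x u)"
  "tLl (x \<rhd> y) u = tLl y (tLr x u)" "tLl (x \<lhd> y) u = tLl y (tLl x u)"
  by (simp_all add: transpose_defs product_assoc)

text \<open>With \<open>transpose_product\<close>, these are the dialgebra axioms read on
  functionals. Mixed composites are oriented so that right multiplications move outwards, which lets
  the simplifier decide the bimodule identities.\<close>

lemma transpose_transpose: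
  "tRl x (tRr y u) = tRr x (tRr y u)" "tLr y (tLl x u) = tLl y (tLl x u)"
  "tLr x (tRr y u) = tRr y (tLr x u)" "tLl x (tRr y u) = tRr y (tLr x u)"
  "tLl x (tRl y u) = tRl y (tLl x u)" "tRr y (tLl x u) = tRl y (tLl x u)"
  "tLr x (tRl y u) = tRl y (tLr x u)"
  by (simp_all add: transpose_defs product_assoc)

lemmas transpose_simps = transpose_in_dual in_dual transpose_linear transpose_linear_arg
  transpose_product transpose_transpose

lemma comp_multiplication:
  assumes "u \<in> D"
  shows "u \<circ> Rm rhd x = tRr x u" "u \<circ> Rm lhd x = tRl x u" "u \<circ> Lm rhd x = tLr x u"
    "u \<circ> Lm lhd x = tLl x u" "u \<circ> Rm (\<star>) x = tRr x u - tRl x u"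
    "u \<circ> Lm (\<star>) x = tLr x u - tLl x u"
  using assms by (simp_all add: fun_eq_iff Rm_def Lm_def star_def transpose_defs dual_linear)

lemma dual_map_multiplication:
  assumes "u \<in> D"
  shows "dual_map (Rm rhd) x u = - tRr x u" "dual_map (Rm lhd) x u = - tRl x u"
    "dual_map (Lm rhd) x u = - tLr x u" "dual_map (Lm lhd) x u = - tLl x u"
    "dual_map (Rm (\<star>)) x u = tRl x u - tRr x u" "dual_map (Lm (\<star>)) x u = tLl x u - tLr x u"
  using assms
  by (simp_all add: fun_eq_iff dual_map_def Rm_def Lm_def star_def transpose_defs dual_linear)

text \<open>The four actions of \<open>x\<close> are \<open>tRl x\<close>,
  \<open>tLr x - tLl x\<close>, \<open>tRl x - tRr x\<close> and \<open>tLr x\<close>, so each axiom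
  is a relation between composites of transposes.\<close>

lemma dialgebra_bimodule_dual:
  "dialgebra_bimodule scale UNIV rhd lhd dual_scale D
    (- dual_map (Rm lhd)) (- dual_map (Lm (\<star>))) (dual_map (Rm (\<star>))) (- dual_map (Lm rhd))"
proof -
  interpret V: fd_space "dual_scale :: 'f \<Rightarrow> ('a \<Rightarrow> 'f) \<Rightarrow> _" D
    by (rule fd_space_dual)
  show ?thesis
    by unfold_locales
      (auto simp: bilinear_on_def linear_on_def dual_map_multiplication transpose_simps
        V.scale_right_diff_distrib)
qed

subsection \<open>The Yang-Baxter equation in terms of the induced maps\<close>

text \<open>Evaluated at three functionals, the double sums factor: coefficients
  \<open>u (a i)\<close> with vectors \<open>b i\<close> form \<open>tilde\<close>, coefficients
  \<open>u (b i)\<close> with vectors \<open>a i\<close> form \<open>tilde_t\<close>. The resulting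
  identity mentions no decomposition.\<close>

lemma solves_DAYBE_iff:
  assumes "r \<in> T2"
  shows "solves_DAYBE scale rhd lhd r \<longleftrightarrow>
    (\<forall>u\<in>D. \<forall>v\<in>D. \<forall>w\<in>D.
      w (tilde scale r u \<rhd> tilde scale r v) =
      v (tilde_t scale r w \<lhd> tilde scale r u) + u (tilde_t scale r v \<star> tilde_t scale r w))"
    (is "_ \<longleftrightarrow> ?pairing")
proof -
  \<comment> \<open>Shown for an arbitrary decomposition, which settles both directions of the
    existential in \<open>solves_DAYBE\<close>.\<close>
  have "(\<Sum>i<n. \<Sum>j<n.
        tensor3 scale (a i) (a j) (rhd (b i) (b j))
      - tensor3 scale (a j) (lhd (a i) (b j)) (b i)
      - tensor3 scale (star rhd lhd (a i) (a j)) (b i) (b j)) = 0 \<longleftrightarrow> ?pairing" (is "?S = 0 \<longleftrightarrow> _")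
    if r: "r = (\<Sum>i<n. tensor scale (a i) (b i))" for n :: nat and a b
  proof -
    have tilde: "tilde scale r u = (\<Sum>i<n. scale (u (a i)) (b i))" if "u \<in> D" for u
      using that by (simp add: r tilde_sum)
    have tilde_t: "tilde_t scale r u = (\<Sum>i<n. scale (u (b i)) (a i))" if "u \<in> D" for u
      using that by (simp add: r tilde_t_eq_tilde_flip flip_sum tilde_sum)
    have "?S u v w = w (tilde scale r u \<rhd> tilde scale r v)
        - v (tilde_t scale r w \<lhd> tilde scale r u) - u (tilde_t scale r v \<star> tilde_t scale r w)"
      if "u \<in> D" "v \<in> D" "w \<in> D" for u v w
    proof -
      have "?S u v w = (\<Sum>i<n. \<Sum>j<n. u (a i) * v (a j) * w (b i \<rhd> b j))
          - (\<Sum>i<n. \<Sum>j<n. w (b i) * u (a j) * v (a i \<lhd> b j))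
          - (\<Sum>i<n. \<Sum>j<n. v (b i) * w (b j) * u (a i \<star> a j))"
        using that by (simp add: sum_apply tensor3_def on_dual3_def sum_subtractf mult_ac)
      then show ?thesis
        unfolding tilde[OF \<open>u \<in> D\<close>] tilde[OF \<open>v \<in> D\<close>] tilde_t[OF \<open>v \<in> D\<close>] tilde_t[OF \<open>w \<in> D\<close>]
        by (simp only: bilinear_sums[OF rhd.bilinear \<open>w \<in> D\<close>] bilinear_sums[OF lhd.bilinear \<open>v \<in> D\<close>]
            bilinear_sums[OF bilinear_star \<open>u \<in> D\<close>])
    qed
    \<comment> \<open>Forms are 0 off the dual space by convention, so the equation of functions
      only has to be checked on functionals.\<close>
    moreover have "?S u v w = 0" if "\<not> (u \<in> D \<and> v \<in> D \<and> w \<in> D)" for u v w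
      using that by (auto simp: sum_apply tensor3_def on_dual3_def)
    ultimately have "?S u v w = (if u \<in> D \<and> v \<in> D \<and> w \<in> D then
        w (tilde scale r u \<rhd> tilde scale r v)
        - v (tilde_t scale r w \<lhd> tilde scale r u) - u (tilde_t scale r v \<star> tilde_t scale r w) else 0)"
      for u v w by auto
    then have "?S = 0 \<longleftrightarrow> (\<forall>u v w. (if u \<in> D \<and> v \<in> D \<and> w \<in> D then
        w (tilde scale r u \<rhd> tilde scale r v)
        - v (tilde_t scale r w \<lhd> tilde scale r u) - u (tilde_t scale r v \<star> tilde_t scale r w) else 0) = 0)"
      by (simp only: fun_eq_iff zero_fun_apply)
    also have "\<dots> \<longleftrightarrow> ?pairing"
      by (auto simp: algebra_simps split: if_splits)
    finally show ?thesis .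
  qed
  then show ?thesis
    using assms unfolding solves_DAYBE_def tensor_square_def by blast
qed

end

section \<open>Consequences of the invariance of the skew-symmetric part\<close>

locale full_dialgebra_invariant = full_dialgebra scale rhd lhd
  for scale :: "'f::field_char_0 \<Rightarrow> 'a::ab_group_add \<Rightarrow> 'a"
    and rhd (infixl "\<rhd>" 70) and lhd (infixl "\<lhd>" 70) +
  fixes r :: "('a, 'f) tens2"
  assumes r_in_tensor_square: "r \<in> T2"
    and skew_part_invariant: "invariant scale rhd lhd (skew_part r)"
begin

abbreviation R where "R \<equiv> tilde scale r"
abbreviation Rt where "Rt \<equiv> tilde_t scale r"
abbreviation P where "P \<equiv> tilde scale (skew_part r)"

lemma P_eq: "u \<in> D \<Longrightarrow> P u = R u - Rt u"
  using r_in_tensor_square by (rule tilde_skew_part)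

lemma dual_R: "u \<in> D \<Longrightarrow> v \<in> D \<Longrightarrow> v (R u) = u (Rt v)"
  using r_in_tensor_square by (simp add: tilde_eval tilde_t_eval)

lemma dual_P: "u \<in> D \<Longrightarrow> v \<in> D \<Longrightarrow> v (P u) = - u (P v)"
  by (simp add: P_eq dual_diff dual_R)

lemmas R_linear = tilde_linear[OF r_in_tensor_square]
lemmas Rt_linear = tilde_linear[OF flip_in_tensor_square[OF r_in_tensor_square], folded tilde_t_eq_tilde_flip]
lemmas P_linear = tilde_linear[OF skew_part_in_tensor_square[OF r_in_tensor_square]]
lemmas r_bilinear = tensor_bilinear[OF r_in_tensor_square]

lemma skew_part_invariance:
  assumes "u \<in> D" "v \<in> D"
  shows "skew_part r (tRr x u - tRl x u) v + skew_part r u (tLl x v) = 0"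
    and "skew_part r (tRr x u) v - skew_part r u (tLr x v - tLl x v) = 0"
proof -
  have "(map_tensor scale (Rm (\<star>) x) id (skew_part r) + map_tensor scale id (Lm lhd x) (skew_part r)) u v = 0"
    and "(map_tensor scale (Rm rhd x) id (skew_part r) - map_tensor scale id (Lm (\<star>) x) (skew_part r)) u v = 0"
    using skew_part_invariant by (simp_all only: invariant_def zero_fun_apply)
  then show "skew_part r (tRr x u - tRl x u) v + skew_part r u (tLl x v) = 0"
    and "skew_part r (tRr x u) v - skew_part r u (tLr x v - tLl x v) = 0"
    using assms by (simp_all add: map_tensor_def on_dual2_def comp_multiplication)
qed

text \<open>Invariance with the terms of \<open>r\<close> on the left and those of its flip on the
  right. The left-hand sides are the values of \<open>dr x\<close> and \<open>dl x\<close> at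
  \<open>u\<close> and \<open>v\<close>, so coproduct coefficients can be rewritten with the
  arguments of \<open>r\<close> exchanged.\<close>

lemma r_invariance:
  assumes "u \<in> D" "v \<in> D"
  shows "r (tRr x u) v - r (tRl x u) v + r u (tLl x v) =
      r v (tRr x u) - r v (tRl x u) + r (tLl x v) u"
    and "r (tRr x u) v - r u (tLr x v) + r u (tLl x v) =
      r v (tRr x u) - r (tLr x v) u + r (tLl x v) u"
  using skew_part_invariance[OF assms, of x] assms
  by (simp_all add: skew_part_def flip_def r_bilinear transpose_in_dual algebra_simps)

text \<open>The difference of the two identities of \<open>r_invariance\<close>, in which
  \<open>tRr\<close> cancels. Its left-hand side is the value of \<open>dr x - dl x\<close>.\<close>

lemma r_invariance_tLr:
  assumes "u \<in> D" "v \<in> D"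
  shows "r u (tLr x v) - r (tRl x u) v = r (tLr x v) u - r v (tRl x u)"
proof -
  have "r u (tLr x v) - r (tRl x u) v =
      (r (tRr x u) v - r (tRl x u) v + r u (tLl x v)) - (r (tRr x u) v - r u (tLr x v) + r u (tLl x v))"
    by (simp add: algebra_simps)
  then show ?thesis
    unfolding r_invariance[OF assms, of x] by (simp add: algebra_simps)
qed

text \<open>This is the statement that \<open>P\<close> is a bimodule morphism from the dual space
  to the algebra. The two rules for right multiplications are invariance tested on a functional;
  those for left multiplications follow by skew-symmetry of \<open>P\<close>, which moves
  \<open>P\<close> to the test functional, where the first two rules apply.\<close>

lemma P_transpose:
  assumes "u \<in> D"
  shows "P (tRr x u) = x \<rhd> P u - x \<lhd> P u" "P (tRl x u) = x \<rhd> P u"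
    "P (tLr x u) = P u \<lhd> x" "P (tLl x u) = P u \<lhd> x - P u \<rhd> x"
proof -
  note P_eval = tilde_eval[OF skew_part_in_tensor_square[OF r_in_tensor_square], symmetric]
  have inv: "v (P (tRr x u)) - v (P (tRl x u)) + v (x \<lhd> P u) = 0"
    "v (P (tRr x u)) - (v (x \<rhd> P u) - v (x \<lhd> P u)) = 0" if "u \<in> D" "v \<in> D" for u v
    using skew_part_invariance[OF that, of x] that
    by (simp_all add: P_eval transpose_simps P_linear dual_diff)
      (simp_all add: transpose_defs)
  have Rr: "P (tRr x u) = x \<rhd> P u - x \<lhd> P u" if "u \<in> D" for u
  proof (rule dual_separates)
    show "v (P (tRr x u)) = v (x \<rhd> P u - x \<lhd> P u)" if "v \<in> D" for v
      using inv(2)[OF \<open>u \<in> D\<close> that] that by (simp add: dual_diff)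
  qed
  have Rl: "P (tRl x u) = x \<rhd> P u" if "u \<in> D" for u
  proof (rule dual_separates)
    show "v (P (tRl x u)) = v (x \<rhd> P u)" if "v \<in> D" for v
      using inv(1)[OF \<open>u \<in> D\<close> that] \<open>u \<in> D\<close> that by (simp add: Rr dual_diff)
  qed
  have Ll: "P (tLl x u) = P u \<lhd> x - P u \<rhd> x" and Lr: "P (tLr x u) = P u \<lhd> x"
  proof -
    have *: "v (P (tLl x u)) = - v (P u \<rhd> x) + v (P u \<lhd> x)"
      "v (P (tLr x u)) = v (P u \<lhd> x)" if v: "v \<in> D" for v
    proof -
      have "v (P (tLl x u)) = - (u (x \<lhd> P v))"
        using assms v by (simp add: dual_P[of "tLl x u" v] transpose_in_dual) (simp add: tLl_def)
      also have "u (x \<lhd> P v) = u (P (tRl x v)) - u (P (tRr x v))"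
        using assms v by (simp add: Rr Rl dual_diff)
      also have "\<dots> = v (P u \<rhd> x) - v (P u \<lhd> x)"
        using assms v by (simp add: dual_P[of _ u] transpose_in_dual) (simp add: transpose_defs)
      finally show "v (P (tLl x u)) = - v (P u \<rhd> x) + v (P u \<lhd> x)"
        by simp
      have "v (P (tLr x u)) = - (u (x \<rhd> P v))"
        using assms v by (simp add: dual_P[of "tLr x u" v] transpose_in_dual) (simp add: tLr_def)
      also have "u (x \<rhd> P v) = u (P (tRl x v))"
        using assms v by (simp add: Rl)
      also have "\<dots> = - v (P u \<lhd> x)"
        using assms v by (simp add: dual_P[of _ u] transpose_in_dual) (simp add: transpose_defs)
      finally show "v (P (tLr x u)) = v (P u \<lhd> x)"
        by simp
    qed
    show "P (tLl x u) = P u \<lhd> x - P u \<rhd> x" "P (tLr x u) = P u \<lhd> x"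
      using * by (auto intro!: dual_separates simp: dual_diff)
  qed
  show "P (tRr x u) = x \<rhd> P u - x \<lhd> P u" "P (tRl x u) = x \<rhd> P u"
    "P (tLr x u) = P u \<lhd> x" "P (tLl x u) = P u \<lhd> x - P u \<rhd> x"
    by (fact Rr[OF assms] Rl[OF assms] Lr Ll)+
qed

text \<open>For each of the two products, the right action of \<open>P v\<close> on \<open>u\<close>
  equals the left action of \<open>P u\<close> on \<open>v\<close>. This is
  \<open>P_transpose\<close> read through the skew-symmetry of \<open>P\<close>.\<close>

lemma transpose_P:
  assumes "u \<in> D" "v \<in> D"
  shows "tLr (P v) u - tLl (P v) u = tRl (P u) v" "tLr (P v) u = tRl (P u) v - tRr (P u) v"
proof -
  have Rl: "v (x \<rhd> P u) = - u (P v \<lhd> x)" for x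
    using dual_P[of "tRl x u" v] assms
    by (simp add: P_transpose transpose_in_dual) (simp add: tRl_def)
  have Rr: "v (x \<lhd> P u) = u (P v \<rhd> x) - u (P v \<lhd> x)" for x
    using dual_P[of "tRr x u" v] assms
    by (simp add: P_transpose transpose_in_dual dual_diff Rl) (simp add: tRr_def algebra_simps)
  show "tLr (P v) u - tLl (P v) u = tRl (P u) v" "tLr (P v) u = tRl (P u) v - tRr (P u) v"
    by (simp_all add: transpose_defs fun_eq_iff Rl Rr)
qed

section \<open>The dual space as a bimodule dialgebra\<close>

lemma rhd_dual_eq: "u \<in> D \<Longrightarrow> rhd_dual scale rhd lhd r u v = tLl (P v) u - tLr (P v) u"
  and lhd_dual_eq: "u \<in> D \<Longrightarrow> lhd_dual scale rhd r u v = - tLr (P v) u"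
  by (simp_all add: rhd_dual_def lhd_dual_def dual_map_multiplication)

text \<open>The products of \<open>u\<close> and \<open>v\<close> are the negatives of the two right
  actions of \<open>P v\<close> on \<open>u\<close>. Since \<open>P\<close> carries actions to
  multiplications, each axiom reduces to a relation between transposes.\<close>

lemma bimodule_dialgebra_dual:
  "bimodule_dialgebra scale UNIV rhd lhd
    dual_scale D (rhd_dual scale rhd lhd r) (lhd_dual scale rhd r)
    (- dual_map (Rm lhd)) (- dual_map (Lm (\<star>))) (dual_map (Rm (\<star>))) (- dual_map (Lm rhd))"
proof -
  interpret bimodule: dialgebra_bimodule scale UNIV rhd lhd dual_scale D
    "- dual_map (Rm lhd)" "- dual_map (Lm (\<star>))" "dual_map (Rm (\<star>))" "- dual_map (Lm rhd)"
    by (rule dialgebra_bimodule_dual)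
  show ?thesis
    by unfold_locales
      (auto simp: bilinear_on_def linear_on_def dual_map_multiplication transpose_simps
        rhd_dual_eq lhd_dual_eq P_linear P_transpose bimodule.rhd.V.scale_right_diff_distrib)
qed

section \<open>Products dual to the coproducts, and multiplicativity of the induced maps\<close>

text \<open>Each product is the left action of \<open>R u\<close> on \<open>v\<close> plus the right
  action of \<open>Rt v\<close> on \<open>u\<close>; \<open>delta_eq_product\<close> identifies them
  as the duals of \<open>dr\<close> and \<open>dl\<close>.\<close>

definition rhd_delta where "rhd_delta u v = tRl (R u) v + tLr (Rt v) u - tLl (Rt v) u"
definition lhd_delta where "lhd_delta u v = tLr (Rt v) u + tRl (R u) v - tRr (R u) v"

lemma products_in_dual: "u \<in> D \<Longrightarrow> v \<in> D \<Longrightarrow> rhd_delta u v \<in> D" "u \<in> D \<Longrightarrow> v \<in> D \<Longrightarrow> lhd_delta u v \<in> D"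
  by (simp_all add: rhd_delta_def lhd_delta_def transpose_simps)

text \<open>Exchanging \<open>R\<close> and \<open>Rt\<close> changes the two summands by the two
  sides of \<open>transpose_P\<close>, which cancel.\<close>

lemma products_eq:
  assumes "u \<in> D" "v \<in> D"
  shows "rhd_delta u v = tRl (Rt u) v + tLr (R v) u - tLl (R v) u"
    "lhd_delta u v = tLr (R v) u + tRl (Rt u) v - tRr (Rt u) v"
  using transpose_P[OF assms] assms
  by (simp_all add: rhd_delta_def lhd_delta_def P_eq transpose_linear_arg algebra_simps)

text \<open>The weight term is plus or minus the right action of \<open>P v\<close> on
  \<open>u\<close>. For weight 1 it replaces \<open>R v\<close> by \<open>Rt v\<close> in the right
  action and gives the products as defined; for weight -1 it replaces \<open>Rt v\<close> by
  \<open>R v\<close> and gives the form in \<open>products_eq\<close>.\<close>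

lemma O_operator_iff:
  "O_operator scale UNIV rhd lhd
      dual_scale D (rhd_dual scale rhd lhd r) (lhd_dual scale rhd r)
      (- dual_map (Rm lhd)) (- dual_map (Lm (\<star>))) (dual_map (Rm (\<star>))) (- dual_map (Lm rhd))
      1 R \<longleftrightarrow>
    (\<forall>u\<in>D. \<forall>v\<in>D. R (rhd_delta u v) = R u \<rhd> R v \<and> R (lhd_delta u v) = R u \<lhd> R v)"
  "O_operator scale UNIV rhd lhd
      dual_scale D (rhd_dual scale rhd lhd r) (lhd_dual scale rhd r)
      (- dual_map (Rm lhd)) (- dual_map (Lm (\<star>))) (dual_map (Rm (\<star>))) (- dual_map (Lm rhd))
      (- 1) Rt \<longleftrightarrow>
    (\<forall>u\<in>D. \<forall>v\<in>D. Rt (rhd_delta u v) = Rt u \<rhd> Rt v \<and> Rt (lhd_delta u v) = Rt u \<lhd> Rt v)"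
proof -
  interpret dual: vector_space "dual_scale :: 'f \<Rightarrow> ('a \<Rightarrow> 'f) \<Rightarrow> _"
    by (rule vector_space_dual_scale)
  have R: "tRl (R u) v + (tLr (R v) u - tLl (R v) u) + (tLl (P v) u - tLr (P v) u) = rhd_delta u v"
      "tRl (R u) v - tRr (R u) v + tLr (R v) u - tLr (P v) u = lhd_delta u v"
    if "u \<in> D" "v \<in> D" for u v
    using that by (simp_all add: rhd_delta_def lhd_delta_def P_eq transpose_linear_arg)
  have Rt: "tRl (Rt u) v + (tLr (Rt v) u - tLl (Rt v) u) + (tLr (P v) u - tLl (P v) u) = rhd_delta u v"
      "tRl (Rt u) v - tRr (Rt u) v + tLr (Rt v) u + tLr (P v) u = lhd_delta u v"
    if "u \<in> D" "v \<in> D" for u v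
    using that by (simp_all add: products_eq P_eq transpose_linear_arg)
  show "O_operator scale UNIV rhd lhd
      dual_scale D (rhd_dual scale rhd lhd r) (lhd_dual scale rhd r)
      (- dual_map (Rm lhd)) (- dual_map (Lm (\<star>))) (dual_map (Rm (\<star>))) (- dual_map (Lm rhd))
      1 R \<longleftrightarrow>
    (\<forall>u\<in>D. \<forall>v\<in>D. R (rhd_delta u v) = R u \<rhd> R v \<and> R (lhd_delta u v) = R u \<lhd> R v)"
    using bimodule_dialgebra_dual
    by (auto simp: O_operator_def O_operator_axioms_def linear_on_def R_linear
        dual_map_multiplication rhd_dual_eq lhd_dual_eq R)
  show "O_operator scale UNIV rhd lhd
      dual_scale D (rhd_dual scale rhd lhd r) (lhd_dual scale rhd r)
      (- dual_map (Rm lhd)) (- dual_map (Lm (\<star>))) (dual_map (Rm (\<star>))) (- dual_map (Lm rhd))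
      (- 1) Rt \<longleftrightarrow>
    (\<forall>u\<in>D. \<forall>v\<in>D. Rt (rhd_delta u v) = Rt u \<rhd> Rt v \<and> Rt (lhd_delta u v) = Rt u \<lhd> Rt v)"
    using bimodule_dialgebra_dual
    by (auto simp: O_operator_def O_operator_axioms_def linear_on_def Rt_linear
        dual_map_multiplication rhd_dual_eq lhd_dual_eq Rt)
qed

text \<open>Applying the bimodule morphism \<open>P\<close> to the first product gives
  \<open>R u \<rhd> P v + P u \<rhd> Rt v\<close>, which telescopes to the difference of the two
  right-hand sides; likewise for the second.\<close>

lemma R_rhd_iff_Rt_rhd:
  assumes "u \<in> D" "v \<in> D"
  shows "R (rhd_delta u v) = R u \<rhd> R v \<longleftrightarrow> Rt (rhd_delta u v) = Rt u \<rhd> Rt v"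
    and "R (lhd_delta u v) = R u \<lhd> R v \<longleftrightarrow> Rt (lhd_delta u v) = Rt u \<lhd> Rt v"
proof -
  have "R (rhd_delta u v) - Rt (rhd_delta u v) = R u \<rhd> R v - Rt u \<rhd> Rt v"
    using assms
    by (simp add: P_eq[symmetric] products_in_dual)
      (simp add: rhd_delta_def P_linear P_transpose transpose_simps, simp add: P_eq product_linear)
  then show "R (rhd_delta u v) = R u \<rhd> R v \<longleftrightarrow> Rt (rhd_delta u v) = Rt u \<rhd> Rt v"
    by (auto simp: algebra_simps)
  have "R (lhd_delta u v) - Rt (lhd_delta u v) = R u \<lhd> R v - Rt u \<lhd> Rt v"
    using assms
    by (simp add: P_eq[symmetric] products_in_dual)
      (simp add: lhd_delta_def P_linear P_transpose transpose_simps, simp add: P_eq product_linear)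
  then show "R (lhd_delta u v) = R u \<lhd> R v \<longleftrightarrow> Rt (lhd_delta u v) = Rt u \<lhd> Rt v"
    by (auto simp: algebra_simps)
qed

text \<open>By \<open>dual_R\<close>, testing \<open>R\<close> of the product on \<open>w\<close>
  evaluates the product at \<open>Rt w\<close>, which is the right-hand side of
  \<open>solves_DAYBE_iff\<close>.\<close>

lemma solves_DAYBE_iff_R_rhd:
  "solves_DAYBE scale rhd lhd r \<longleftrightarrow> (\<forall>u\<in>D. \<forall>v\<in>D. R (rhd_delta u v) = R u \<rhd> R v)"
proof -
  have "R (rhd_delta u v) = R u \<rhd> R v \<longleftrightarrow>
      (\<forall>w\<in>D. w (R u \<rhd> R v) = v (Rt w \<lhd> R u) + u (Rt v \<star> Rt w))"
    if "u \<in> D" "v \<in> D" for u v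
  proof -
    have "w (R (rhd_delta u v)) = v (Rt w \<lhd> R u) + u (Rt v \<star> Rt w)" if "w \<in> D" for w
      using \<open>u \<in> D\<close> \<open>v \<in> D\<close> that
      by (simp add: dual_R products_in_dual) (simp add: rhd_delta_def transpose_defs star_def dual_diff)
    then show ?thesis
      by (metis dual_separates)
  qed
  then show ?thesis
    unfolding solves_DAYBE_iff[OF r_in_tensor_square] by blast
qed

text \<open>
  Tested against a third functional, the two conditions are the same trilinear identity with
  cyclically permuted arguments.
\<close>

lemma R_lhd_iff_Rt_rhd:
  "(\<forall>u\<in>D. \<forall>v\<in>D. R (lhd_delta u v) = R u \<lhd> R v) \<longleftrightarrow> (\<forall>u\<in>D. \<forall>v\<in>D. Rt (rhd_delta u v) = Rt u \<rhd> Rt v)"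
proof -
  have lhd_delta: "R (lhd_delta u v) = R u \<lhd> R v \<longleftrightarrow>
      (\<forall>w\<in>D. w (R u \<lhd> R v) = u (Rt v \<rhd> Rt w) + v (Rt w \<lhd> R u) - v (Rt w \<rhd> R u))"
    if "u \<in> D" "v \<in> D" for u v
  proof -
    have "w (R (lhd_delta u v)) = u (Rt v \<rhd> Rt w) + v (Rt w \<lhd> R u) - v (Rt w \<rhd> R u)" if "w \<in> D" for w
      using \<open>u \<in> D\<close> \<open>v \<in> D\<close> that
      by (simp add: dual_R products_in_dual) (simp add: lhd_delta_def transpose_defs)
    then show ?thesis
      by (metis dual_separates)
  qed
  have rhd_delta: "Rt (rhd_delta u v) = Rt u \<rhd> Rt v \<longleftrightarrow>
      (\<forall>w\<in>D. w (Rt u \<rhd> Rt v) = v (R w \<lhd> R u) + u (Rt v \<rhd> R w) - u (Rt v \<lhd> R w))"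
    if "u \<in> D" "v \<in> D" for u v
  proof -
    have "w (Rt (rhd_delta u v)) = v (R w \<lhd> R u) + u (Rt v \<rhd> R w) - u (Rt v \<lhd> R w)" if "w \<in> D" for w
      using \<open>u \<in> D\<close> \<open>v \<in> D\<close> that
      by (simp flip: dual_R add: products_in_dual) (simp add: rhd_delta_def transpose_defs)
    then show ?thesis
      by (metis dual_separates)
  qed
  have "(\<forall>u\<in>D. \<forall>v\<in>D. R (lhd_delta u v) = R u \<lhd> R v) \<longleftrightarrow> (\<forall>u\<in>D. \<forall>v\<in>D. \<forall>w\<in>D.
      w (R u \<lhd> R v) = u (Rt v \<rhd> Rt w) + v (Rt w \<lhd> R u) - v (Rt w \<rhd> R u))"
    using lhd_delta by blast
  also have "\<dots> \<longleftrightarrow> (\<forall>u\<in>D. \<forall>v\<in>D. \<forall>w\<in>D.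
      w (Rt u \<rhd> Rt v) = v (R w \<lhd> R u) + u (Rt v \<rhd> R w) - u (Rt v \<lhd> R w))"
  proof -
    have "v (R w \<lhd> R u) = w (Rt u \<rhd> Rt v) + u (Rt v \<lhd> R w) - u (Rt v \<rhd> R w) \<longleftrightarrow>
        w (Rt u \<rhd> Rt v) = v (R w \<lhd> R u) + u (Rt v \<rhd> R w) - u (Rt v \<lhd> R w)" for u v w
      by (auto simp: algebra_simps)
    then show ?thesis
      by blast
  qed
  also have "\<dots> \<longleftrightarrow> (\<forall>u\<in>D. \<forall>v\<in>D. Rt (rhd_delta u v) = Rt u \<rhd> Rt v)"
    using rhd_delta by blast
  finally show ?thesis .
qed

text \<open>The equation gives the first identity; each further one follows from its predecessor,
  alternately by passing between \<open>R\<close> and \<open>Rt\<close> and by cyclic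
  permutation.\<close>

lemma solves_DAYBE_homomorphisms:
  assumes "solves_DAYBE scale rhd lhd r" "u \<in> D" "v \<in> D"
  shows "R (rhd_delta u v) = R u \<rhd> R v" "Rt (rhd_delta u v) = Rt u \<rhd> Rt v"
    "R (lhd_delta u v) = R u \<lhd> R v" "Rt (lhd_delta u v) = Rt u \<lhd> Rt v"
  using assms R_rhd_iff_Rt_rhd R_lhd_iff_Rt_rhd solves_DAYBE_iff_R_rhd by blast+

subsection \<open>The coboundary bi-dialgebra\<close>

abbreviation dr where "dr \<equiv> delta_rhd scale rhd lhd r"
abbreviation dl where "dl \<equiv> delta_lhd scale rhd lhd r"

lemma delta_eval:
  "dr x u v = (if u \<in> D \<and> v \<in> D then r (tRr x u - tRl x u) v + r u (tLl x v) else 0)"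
  "dl x u v = (if u \<in> D \<and> v \<in> D then r (tRr x u) v - r u (tLr x v - tLl x v) else 0)"
  by (auto simp: delta_rhd_def delta_lhd_def map_tensor_def on_dual2_def comp_multiplication)

lemma delta_eq_product:
  assumes "u \<in> D" "v \<in> D"
  shows "dr x u v = rhd_delta u v x" "dl x u v = lhd_delta u v x"
proof -
  have eval: "r (tRr x u) v = u (Rt v \<rhd> x)" "r (tRl x u) v = u (Rt v \<lhd> x)"
    "r u (tLr x v) = v (x \<rhd> R u)" "r u (tLl x v) = v (x \<lhd> R u)"
    using assms r_in_tensor_square
    by (simp_all flip: tilde_eval[of r u] tilde_t_eval[of r _ v] add: transpose_in_dual)
      (simp_all add: transpose_defs)
  show "dr x u v = rhd_delta u v x" "dl x u v = lhd_delta u v x"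
    using assms by (simp_all add: delta_eval r_bilinear transpose_in_dual eval rhd_delta_def lhd_delta_def)
      (simp_all add: transpose_defs)
qed

lemma linear_delta:
  "linear_on scale UNIV tensor_scale T2 dr" "linear_on scale UNIV tensor_scale T2 dl"
proof -
  have "dr x \<in> T2" "dl x \<in> T2" for x
    using r_in_tensor_square unfolding delta_rhd_def delta_lhd_def
    by (auto intro!: tensor_square_add tensor_square_diff map_tensor_in_tensor_square
        linear_multiplication)
  then show "linear_on scale UNIV tensor_scale T2 dr" "linear_on scale UNIV tensor_scale T2 dl"
    by (auto simp: linear_on_def fun_eq_iff delta_eval tensor_scale_def transpose_simps r_bilinear
        algebra_simps)
qed

text \<open>Fixing two functionals turns a coproduct into the functional that is their product, so
  iterated coproducts are evaluated by iterated products. The five compatibility axioms become the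
  dialgebra axioms collected in \<open>assoc\<close>.\<close>

lemma delta_codialgebra:
  assumes "solves_DAYBE scale rhd lhd r"
  shows "codialgebra scale dr dl"
proof -
  note hom = solves_DAYBE_homomorphisms[OF assms]
  \<comment> \<open>Only a product with a product as argument is unfolded here, so that
    \<open>hom\<close> can rewrite \<open>R\<close> and \<open>Rt\<close> of the inner product
    before that is unfolded too.\<close>
  note products = rhd_delta_def[of "rhd_delta _ _"] rhd_delta_def[of "lhd_delta _ _"]
    lhd_delta_def[of "rhd_delta _ _"] lhd_delta_def[of "lhd_delta _ _"]
    rhd_delta_def[of _ "rhd_delta _ _"] rhd_delta_def[of _ "lhd_delta _ _"]
    lhd_delta_def[of _ "rhd_delta _ _"] lhd_delta_def[of _ "lhd_delta _ _"]
  have assoc: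
    "rhd_delta (rhd_delta u v) w = rhd_delta u (rhd_delta v w)"
    "lhd_delta (lhd_delta u v) w = lhd_delta u (lhd_delta v w)"
    "lhd_delta u (lhd_delta v w) = lhd_delta u (rhd_delta v w)"
    "lhd_delta (rhd_delta u v) w = rhd_delta u (lhd_delta v w)"
    "rhd_delta (lhd_delta u v) w = rhd_delta (rhd_delta u v) w"
    if "u \<in> D" "v \<in> D" "w \<in> D" for u v w
    using that
    by (simp_all add: products hom products_in_dual transpose_simps)
      (simp_all add: rhd_delta_def lhd_delta_def transpose_simps)
  have rhd_delta: "(\<lambda>x. dr x u v) = rhd_delta u v" and lhd_delta: "(\<lambda>x. dl x u v) = lhd_delta u v"
    if "u \<in> D" "v \<in> D" for u v
    using that by (simp_all add: delta_eq_product)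
  show ?thesis
    by unfold_locales
      (auto simp: linear_delta fun_eq_iff tensor_id_def id_tensor_def on_dual3_def
        rhd_delta lhd_delta delta_eq_product products_in_dual assoc)
qed

text \<open>The axioms without a flip are relations between transposes. In those with a flip,
  invariance exchanges the arguments of \<open>r\<close>.\<close>

lemma delta_bi_dialgebra:
  assumes "solves_DAYBE scale rhd lhd r"
  shows "bi_dialgebra scale rhd lhd dr dl"
proof -
  interpret co: codialgebra scale dr dl
    using assms by (rule delta_codialgebra)
  note simps = map_tensor_def on_dual2_def flip_def delta_eval comp_multiplication
    transpose_simps r_bilinear
  have tens2_eqI: "t = t'" if "\<And>u v. u \<in> D \<Longrightarrow> v \<in> D \<Longrightarrow> t u v = t' u v"
      "\<And>u v. \<not> (u \<in> D \<and> v \<in> D) \<Longrightarrow> t u v = t' u v" for t t' :: "('a, 'f) tens2"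
    using that by blast
  interpret dialgebra_codialgebra scale rhd lhd dr dl ..
  show ?thesis
  proof unfold_locales
    fix x y
    show "(id\<otimes> (L\<^sub>\<lhd> x)) (dl y) = ((R\<^sub>\<rhd> y) \<otimes>id) (dr x)"
      by (rule tens2_eqI) (auto simp: simps)
    \<comment> \<open>\<open>tRr y\<close> and \<open>tRl y\<close> agree on \<open>tLl x u\<close>,
      so both sides reduce to values of \<open>r\<close> at \<open>tLl x u\<close> and
      \<open>tLl y v\<close>, in opposite orders; invariance equates them.\<close>
    show "((L\<^sub>\<lhd> x) \<otimes>id) (dr y) = (id\<otimes> (L\<^sub>\<lhd> y)) (\<tau> (dr x))"
    proof (rule tens2_eqI)
      fix u v assume uv: "u \<in> D" "v \<in> D"
      then show "((L\<^sub>\<lhd> x) \<otimes>id) (dr y) u v = (id\<otimes> (L\<^sub>\<lhd> y)) (\<tau> (dr x)) u v"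
        using r_invariance(1)[of "tLl x u" v y]
        by (simp add: simps)
    qed (auto simp: simps)
    \<comment> \<open>The same cancellation, now because \<open>tLr\<close> and \<open>tLl\<close>
      agree after \<open>tRr\<close>; what remains is \<open>r\<close> at \<open>tRr x u\<close> and
      \<open>tRr y v\<close> in both orders.\<close>
    show "((R\<^sub>\<rhd> x) \<otimes>id) (\<tau> (dl y)) = (id\<otimes> (R\<^sub>\<rhd> y)) (dl x)"
    proof (rule tens2_eqI)
      fix u v assume uv: "u \<in> D" "v \<in> D"
      then show "((R\<^sub>\<rhd> x) \<otimes>id) (\<tau> (dl y)) u v = (id\<otimes> (R\<^sub>\<rhd> y)) (dl x) u v"
        using r_invariance(2)[of u "tRr y v" x]
        by (simp add: simps)
    qed (auto simp: simps)
    show "dr (x \<rhd> y) = (id\<otimes> (L\<^sub>\<rhd> x)) (dr y) - ((R\<^sub>\<star> y) \<otimes>id) (dr x - dl x)"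
      by (rule tens2_eqI) (auto simp: simps)
    show "dr (x \<lhd> y) = (id\<otimes> (L\<^sub>\<lhd> x)) (dr y - dl y) + ((R\<^sub>\<lhd> y) \<otimes>id) (dr x)"
      by (rule tens2_eqI) (auto simp: simps)
    show "dl (x \<rhd> y) = (id\<otimes> (L\<^sub>\<star> x)) (dl y) + ((R\<^sub>\<rhd> y) \<otimes>id) (dl x)"
      by (rule tens2_eqI) (auto simp: simps)
    show "dl (x \<lhd> y) = ((R\<^sub>\<lhd> y) \<otimes>id) (dl x) - (id\<otimes> (L\<^sub>\<star> x)) (dr y - dl y)"
      by (rule tens2_eqI) (auto simp: simps)
    \<comment> \<open>The two instances of invariance are taken at the arguments at which the two
      sides evaluate \<open>dr y\<close>.\<close>
    show "((L\<^sub>\<star> x) \<otimes>id) (dr y) + (id\<otimes> (L\<^sub>\<lhd> y)) (\<tau> (dl x)) =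
        ((R\<^sub>\<star> y) \<otimes>id) (\<tau> (dr x - dl x)) + (id\<otimes> (R\<^sub>\<lhd> x)) (dr y)"
    proof (rule tens2_eqI)
      fix u v assume uv: "u \<in> D" "v \<in> D"
      then show "(((L\<^sub>\<star> x) \<otimes>id) (dr y) + (id\<otimes> (L\<^sub>\<lhd> y)) (\<tau> (dl x))) u v =
          (((R\<^sub>\<star> y) \<otimes>id) (\<tau> (dr x - dl x)) + (id\<otimes> (R\<^sub>\<lhd> x)) (dr y)) u v"
        using r_invariance(1)[of "tLr x u - tLl x u" v y] r_invariance(1)[of u "tRl x v" y]
        by (simp add: simps)
    qed (auto simp: simps)
    \<comment> \<open>Here the instances are the arguments at which the two sides evaluate
      \<open>dr x - dl x\<close>.\<close>
    show "((R\<^sub>\<lhd> x) \<otimes>id) (\<tau> (dl y)) + (id\<otimes> (R\<^sub>\<rhd> y)) (dr x - dl x) =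
        ((L\<^sub>\<star> y) \<otimes>id) (dr x - dl x) + (id\<otimes> (L\<^sub>\<rhd> x)) (\<tau> (dl y))"
    proof (rule tens2_eqI)
      fix u v assume uv: "u \<in> D" "v \<in> D"
      then show "(((R\<^sub>\<lhd> x) \<otimes>id) (\<tau> (dl y)) + (id\<otimes> (R\<^sub>\<rhd> y)) (dr x - dl x)) u v =
          (((L\<^sub>\<star> y) \<otimes>id) (dr x - dl x) + (id\<otimes> (L\<^sub>\<rhd> x)) (\<tau> (dl y))) u v"
        using r_invariance_tLr[of u "tRr y v" x] r_invariance_tLr[of "tLr y u - tLl y u" v x]
        by (simp add: simps) algebra
    qed (auto simp: simps)
  qed
qed

end

theorem theorem3p31:
  fixes scale :: "'f::field_char_0 \<Rightarrow> 'a::ab_group_add \<Rightarrow> 'a"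
    and rhd lhd :: "'a \<Rightarrow> 'a \<Rightarrow> 'a"
    and r :: "('a, 'f) tens2"
  assumes "dialgebra scale UNIV rhd lhd"
    and "r \<in> tensor_square scale"
    and "invariant scale rhd lhd (skew_part r)"
  shows
    "(solves_DAYBE scale rhd lhd r \<and> quasi_triangular scale rhd lhd r \<longleftrightarrow>
      O_operator scale UNIV rhd lhd
        dual_scale (dual scale) (rhd_dual scale rhd lhd r) (lhd_dual scale rhd r)
        (- dual_map (Rm lhd)) (- dual_map (Lm (star rhd lhd)))
        (dual_map (Rm (star rhd lhd))) (- dual_map (Lm rhd))
        1 (tilde scale r)) \<and>
     (solves_DAYBE scale rhd lhd r \<and> quasi_triangular scale rhd lhd r \<longleftrightarrow>
      O_operator scale UNIV rhd lhd
        dual_scale (dual scale) (rhd_dual scale rhd lhd r) (lhd_dual scale rhd r)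
        (- dual_map (Rm lhd)) (- dual_map (Lm (star rhd lhd)))
        (dual_map (Rm (star rhd lhd))) (- dual_map (Lm rhd))
        (- 1) (tilde_t scale r))"
proof -
  interpret dialgebra scale UNIV rhd lhd
    by (fact assms(1))
  interpret full_dialgebra_invariant scale rhd lhd r
    using assms(2,3) by unfold_locales
  \<comment> \<open>Given invariance, a solution already makes the coproducts a bi-dialgebra, so the
    first condition is the equation itself.\<close>
  have "solves_DAYBE scale rhd lhd r \<and> quasi_triangular scale rhd lhd r \<longleftrightarrow>
      solves_DAYBE scale rhd lhd r"
    using assms(3) delta_bi_dialgebra by (auto simp: quasi_triangular_def)
  \<comment> \<open>Multiplicativity of \<open>R\<close> and of \<open>Rt\<close> for either product
    gives four equivalent conditions, one of which is the equation; each O-operator condition is a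
    pair of them.\<close>
  then show ?thesis
    unfolding O_operator_iff
    using R_rhd_iff_Rt_rhd R_lhd_iff_Rt_rhd solves_DAYBE_iff_R_rhd by blast
qed

end
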